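(* Let $n,a,b$ be fixed, let $c(t)\in[0,1]$ for all $t\ge1$, and let $K=K(T)\in\{0,\dots,T-1\}$ be a switching-budget sequence with $K(T)=o(T)$ as $T\to\infty$. For each sufficiently large $T$ (so that $T\ge 2$ and $K(T)\le T-2$), run the Fixed Share algorithm over the horizon $T$ on the cost-sensitive expert losses $\tilde\ell_j(t)$ with parameters $(\eta,\alpha)=(\eta^*,\alpha^* )$ depending on $T$ and $K=K(T)$, chosen as follows, where $A_T:=\frac18\sum_{t=1}^T(b-a+2c(t))^2+\sum_{t=2}^Tc(t)(b-a+2c(t-1))$ and $C_T:=\sum_{t=1}^Tc(t)$: (1) if $C_T=0$: $\alpha^*=\frac K{T-1}$ and $\eta^*=\frac1{b-a}\sqrt{\frac8T\left((K+1)\log n+(T-1)H\left(\frac K{T-1}\right)\right)}$; (2) if $C_T>0$ and $K=0$: $\alpha^*=0$ and $\eta^*=\sqrt{\frac{\log n}{A_T}}$; (3) if $C_T>0$ and $K\ge1$: $\alpha^*$ is the unique solution in $\left(0,\frac K{T-1}\right)$ of $\frac{K-(T-1)\alpha}{\alpha(1-\alpha)}=2\left(1-\frac1n\right)C_T\sqrt{\frac{\mathcal C(K,\alpha,n,T)}{A_T}}$, and $\eta^*=\sqrt{\frac{\mathcal C(K,\alpha^*,n,T)}{A_T}}$. Then the cost-sensitive tracking regret satisfies $$\limsup_{T\to\infty}\frac{R^c_{\rm track}(T,K(T))}{T}\le0.$$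
   Context: Let $m\ge2$ (number of assets), $\mathcal W:=\{\mathbf w\in\mathbb R_+^m:\mathbf w^\top\mathbf 1=1\}$, and $\mathcal Y\subseteq\mathbb R^m$. Let $\mathcal N$ be a finite set of $n\ge2$ experts. The loss $\ell:\mathcal W\times\mathcal Y\to\mathbb R$ is convex in its first argument and satisfies $a\le\ell(\mathbf w,\mathbf y)\le b$ for all $(\mathbf w,\mathbf y)$, where $a<b$ are fixed real constants. A prescribed initial portfolio $\mathbf w_0\in\mathcal W$ is given. Each expert $j\in\mathcal N$ provides portfolios $\mathbf w_j(t)\in\mathcal W$ for $t\ge1$, with $\mathbf w_j(0):=\mathbf w_0$; the outcomes are $\mathbf y(t)\in\mathcal Y$, $t\ge1$ (arbitrary). The cost-sensitive loss of expert $j$ at time $t\ge1$ is $\tilde\ell_j(t):=\ell(\mathbf w_j(t),\mathbf y(t))+c(t)\|\mathbf w_j(t)-\mathbf w_j(t-1)\|_1$. Fixed Share with learning rate $\eta>0$ and mixing parameter $\alpha\in[0,1)$: $q_j(1)=1/n$ for all $j\in\mathcal N$, and for $t\ge1$, $$q_j^{\mathrm{exp}}(t)=\frac{q_j(t)e^{-\eta\tilde\ell_j(t)}}{\sum_{k\in\mathcal N}q_k(t)e^{-\eta\tilde\ell_k(t)}},\qquad q_j(t+1)=(1-\alpha)q_j^{\mathrm{exp}}(t)+\frac{\alpha}{n}.$$ The weights (and hence the aggregate portfolio) depend on the horizon $T$ through the parameters. The aggregate portfolio is $\widehat{\mathbf w}(t):=\sum_{j\in\mathcal N}q_j(t)\mathbf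 w_j(t)$ for $t\ge1$, with $\widehat{\mathbf w}(0):=\mathbf w_0$. For $\mathbf j=(j_1,\dots,j_T)\in\mathcal N^T$, let $S_T(\mathbf j):=\#\{t\in\{1,\dots,T-1\}:j_t\ne j_{t+1}\}$ and $\mathcal J_{T,K}:=\{\mathbf j\in\mathcal N^T:S_T(\mathbf j)\le K\}$. The cost-sensitive tracking regret is $$R^c_{\rm track}(T,K):=\sum_{t=1}^T\left[\ell(\widehat{\mathbf w}(t),\mathbf y(t))+c(t)\|\widehat{\mathbf w}(t)-\widehat{\mathbf w}(t-1)\|_1\right]-\min_{\mathbf j\in\mathcal J_{T,K}}\sum_{t=1}^T\tilde\ell_{j_t}(t).$$ The binary entropy is $H(x):=-x\log x-(1-x)\log(1-x)$ on $[0,1]$ with $0\log0:=0$, and $$\mathcal C(K,\alpha,n,T):=\begin{cases}\log n&\text{if }\alpha=0\text{ and }K=0,\\ \infty&\text{if }\alpha=0\text{ and }K>0,\\ (K+1)\log n+K\log\frac1\alpha+(T-K-1)\log\frac1{1-\alpha}&\text{otherwise.}\end{cases}$$ In case (3), existence and uniqueness of the solution $\alpha^*$ holds whenever $T\ge2$ and $1\le K\le T-2$. *)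

theory Defs
  imports "HOL-Analysis.Analysis" "HOL-Library.FuncSet" "HOL-Library.Landau_Symbols"
begin

definition portfolios :: "(real ^ 'm) set" where
  "portfolios = {w. (\<forall>i. 0 \<le> w $ i) \<and> (\<Sum>i\<in>UNIV. w $ i) = 1}"

definition norm1 :: "real ^ 'm \<Rightarrow> real" where
  "norm1 x = (\<Sum>i\<in>UNIV. \<bar>x $ i\<bar>)"

text \<open>Cost-sensitive loss at time \<open>t \<ge> 1\<close> of a portfolio trajectory \<open>v\<close>, where \<open>v 0\<close> is the
  initial portfolio. It is used both for the experts and for the aggregate portfolio.\<close>

definition cost_loss ::
  "(real ^ 'm \<Rightarrow> real ^ 'm \<Rightarrow> real) \<Rightarrow> (nat \<Rightarrow> real ^ 'm) \<Rightarrow> (nat \<Rightarrow> real) \<Rightarrow>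
   (nat \<Rightarrow> real ^ 'm) \<Rightarrow> nat \<Rightarrow> real" where
  "cost_loss loss y c v t = loss (v t) (y t) + c t * norm1 (v t - v (t - 1))"

definition exp_update ::
  "'e set \<Rightarrow> real \<Rightarrow> ('e \<Rightarrow> real) \<Rightarrow> ('e \<Rightarrow> real) \<Rightarrow> 'e \<Rightarrow> real" where
  "exp_update N \<eta> L q j = q j * exp (- \<eta> * L j) / (\<Sum>k\<in>N. q k * exp (- \<eta> * L k))"

text \<open>Fixed Share weights for losses \<open>L j t\<close>. Time starts at \<open>1\<close>; the value at time \<open>0\<close> is a
  dummy that is never used.\<close>

primrec fixed_share ::
  "'e set \<Rightarrow> real \<Rightarrow> real \<Rightarrow> ('e \<Rightarrow> nat \<Rightarrow> real) \<Rightarrow> nat \<Rightarrow> 'e \<Rightarrow> real" where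
  "fixed_share N \<eta> \<alpha> L 0 = (\<lambda>j. 0)"
| "fixed_share N \<eta> \<alpha> L (Suc t) =
     (if t = 0 then (\<lambda>j. 1 / real (card N))
      else (\<lambda>j. (1 - \<alpha>) * exp_update N \<eta> (\<lambda>k. L k t) (fixed_share N \<eta> \<alpha> L t) j
                + \<alpha> / real (card N)))"

definition aggregate ::
  "'e set \<Rightarrow> (nat \<Rightarrow> 'e \<Rightarrow> real) \<Rightarrow> ('e \<Rightarrow> nat \<Rightarrow> real ^ 'm) \<Rightarrow> real ^ 'm \<Rightarrow> nat \<Rightarrow> real ^ 'm" where
  "aggregate N q w w0 t = (if t = 0 then w0 else (\<Sum>j\<in>N. q t j *\<^sub>R w j t))"

definition num_switches :: "nat \<Rightarrow> (nat \<Rightarrow> 'e) \<Rightarrow> nat" where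
  "num_switches T js = card {t \<in> {1..<T}. js t \<noteq> js (t + 1)}"

text \<open>Expert sequences of length \<open>T\<close> are extensional functions on \<open>{1..T}\<close>.\<close>

definition switch_seqs :: "'e set \<Rightarrow> nat \<Rightarrow> nat \<Rightarrow> (nat \<Rightarrow> 'e) set" where
  "switch_seqs N T K = {js \<in> {1..T} \<rightarrow>\<^sub>E N. num_switches T js \<le> K}"

definition fixed_share_portfolio ::
  "'e set \<Rightarrow> (real ^ 'm \<Rightarrow> real ^ 'm \<Rightarrow> real) \<Rightarrow> (nat \<Rightarrow> real ^ 'm) \<Rightarrow> (nat \<Rightarrow> real) \<Rightarrow>
   ('e \<Rightarrow> nat \<Rightarrow> real ^ 'm) \<Rightarrow> real ^ 'm \<Rightarrow> real \<Rightarrow> real \<Rightarrow> nat \<Rightarrow> real ^ 'm" where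
  "fixed_share_portfolio N loss y c w w0 \<eta> \<alpha> =
     aggregate N (fixed_share N \<eta> \<alpha> (\<lambda>j. cost_loss loss y c (w j))) w w0"

definition tracking_regret ::
  "'e set \<Rightarrow> (real ^ 'm \<Rightarrow> real ^ 'm \<Rightarrow> real) \<Rightarrow> (nat \<Rightarrow> real ^ 'm) \<Rightarrow> (nat \<Rightarrow> real) \<Rightarrow>
   ('e \<Rightarrow> nat \<Rightarrow> real ^ 'm) \<Rightarrow> (nat \<Rightarrow> real ^ 'm) \<Rightarrow> nat \<Rightarrow> nat \<Rightarrow> real" where
  "tracking_regret N loss y c w v T K =
     (\<Sum>t=1..T. cost_loss loss y c v t)
     - Min ((\<lambda>js. \<Sum>t=1..T. cost_loss loss y c (w (js t)) t) ` switch_seqs N T K)"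

text \<open>The convention \<open>0 log 0 = 0\<close> holds automatically.\<close>

definition binary_entropy :: "real \<Rightarrow> real" where
  "binary_entropy x = - x * ln x - (1 - x) * ln (1 - x)"

definition complexity :: "nat \<Rightarrow> real \<Rightarrow> nat \<Rightarrow> nat \<Rightarrow> ereal" where
  "complexity K \<alpha> n T =
     (if \<alpha> = 0 \<and> K = 0 then ereal (ln (real n))
      else if \<alpha> = 0 \<and> K > 0 then \<infinity>
      else ereal ((real K + 1) * ln (real n) + real K * ln (1 / \<alpha>)
                  + (real T - real K - 1) * ln (1 / (1 - \<alpha>))))"

definition A_const :: "real \<Rightarrow> real \<Rightarrow> (nat \<Rightarrow> real) \<Rightarrow> nat \<Rightarrow> real" where
  "A_const a b c T = 1 / 8 * (\<Sum>t=1..T. (b - a + 2 * c t)\<^sup>2)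
                     + (\<Sum>t=2..T. c t * (b - a + 2 * c (t - 1)))"

definition C_const :: "(nat \<Rightarrow> real) \<Rightarrow> nat \<Rightarrow> real" where
  "C_const c T = (\<Sum>t=1..T. c t)"

text \<open>The defining equation of the mixing parameter when \<open>C_const c T > 0\<close> and \<open>K \<ge> 1\<close>. On the
  open interval, \<open>complexity\<close> is finite for \<open>K \<le> T - 2\<close>, so \<open>real_of_ereal\<close> is harmless.\<close>

definition alpha_equation ::
  "nat \<Rightarrow> real \<Rightarrow> real \<Rightarrow> (nat \<Rightarrow> real) \<Rightarrow> nat \<Rightarrow> nat \<Rightarrow> real \<Rightarrow> bool" where
  "alpha_equation n a b c T K \<alpha> \<longleftrightarrow>
     (real K - (real T - 1) * \<alpha>) / (\<alpha> * (1 - \<alpha>)) =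
     2 * (1 - 1 / real n) * C_const c T *
       sqrt (real_of_ereal (complexity K \<alpha> n T) / A_const a b c T)"

text \<open>The tuned parameters are meaningful for \<open>T \<ge> 2\<close> and \<open>K \<le> T - 2\<close>; in that range the solution
  selected by the definite description exists and is unique (for \<open>n \<ge> 2\<close>, \<open>a < b\<close>, \<open>0 \<le> c t\<close>).\<close>

definition alpha_star ::
  "nat \<Rightarrow> real \<Rightarrow> real \<Rightarrow> (nat \<Rightarrow> real) \<Rightarrow> nat \<Rightarrow> nat \<Rightarrow> real" where
  "alpha_star n a b c T K =
     (if C_const c T = 0 then real K / (real T - 1)
      else if K = 0 then 0
      else (THE \<alpha>. \<alpha> \<in> {0<..<real K / (real T - 1)} \<and> alpha_equation n a b c T K \<alpha>))"

definition eta_star ::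
  "nat \<Rightarrow> real \<Rightarrow> real \<Rightarrow> (nat \<Rightarrow> real) \<Rightarrow> nat \<Rightarrow> nat \<Rightarrow> real" where
  "eta_star n a b c T K =
     (if C_const c T = 0 then
        1 / (b - a) * sqrt (8 / real T * ((real K + 1) * ln (real n)
          + (real T - 1) * binary_entropy (real K / (real T - 1))))
      else if K = 0 then sqrt (ln (real n) / A_const a b c T)
      else sqrt (real_of_ereal (complexity K (alpha_star n a b c T K) n T) / A_const a b c T))"

end

theory Submission
  imports Defs
begin

text \<open>
Against a comparator with at most \<open>K\<close> switches, the aggregate portfolio pays for three things.
First, there is the regret of the weights for the linearised losses \<open>\<Sum>j\<in>N. q t j * L j t\<close>. The
comparator keeps a share of the total weight that shrinks only by \<open>1 - \<alpha>\<close> when it stays and by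
\<open>\<alpha> / n\<close> when it switches, so the logarithmic loss of Fixed Share exceeds that of the comparator by
at most the complexity \<open>C\<close> (lemmas \<open>fixed_share_mix_loss\<close>, \<open>switching_penalty_le\<close>), and passing
from logarithmic to expected losses costs \<open>O(\<eta>\<^sup>2)\<close> per round (\<open>expected_loss_le_mix_loss\<close>).
Second, the aggregate portfolio moves not only because the experts move, which their own
cost-sensitive losses already account for, but also because the weights move; and third, the
uniform mixing moves the weights as well. In one round these two movements amount to
\<open>O(\<eta>)\<close> and \<open>O(\<alpha>)\<close> (\<open>fixed_share_drift\<close>). Altogether the regret is at most
\<open>C / \<eta> + T * (O(\<eta>) + 2 * \<alpha>)\<close> (\<open>fixed_share_regret_bound\<close>).

All three tuning rules set \<open>\<eta> = sqrt (C / A)\<close> with \<open>A\<close> of exact order \<open>T\<close>, so the average regret is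
\<open>O(sqrt (C / T) + \<alpha>)\<close>, whatever the constants in the bound. Since \<open>\<alpha> \<le> K / (T - 1)\<close>, it remains to
see that \<open>C = o(T)\<close>, and the only dangerous term in \<open>C\<close> is \<open>K * ln (1 / \<alpha>)\<close>: the mixing parameter
must not be too small. If \<open>\<alpha>\<close> were much smaller than \<open>K / T\<close>, then \<open>- dC/d\<alpha>\<close>, which is of order
\<open>K / \<alpha>\<close>, would exceed the other side of the balance equation, which is only of order
\<open>sqrt (T * C)\<close> with \<open>C = O(K / \<alpha>)\<close> (\<open>sqrt_complexity_less_marginal\<close>). Hence
\<open>1 / \<alpha> = O(T / K)\<close>, and \<open>ln u \<le> 2 * sqrt u\<close> gives \<open>K * ln (1 / \<alpha>) = O(sqrt (K * T)) = o(T)\<close>.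
The same comparison of the two sides near \<open>0\<close> supplies one end of the intermediate value argument
for the existence of \<open>\<alpha>\<close> (\<open>ex1_balance\<close>).
\<close>


section \<open>One round of exponential weights\<close>

lemma exp_minus_le_quadratic:
  fixes x :: real
  assumes "0 \<le> x"
  shows "exp (- x) \<le> 1 - x + x\<^sup>2 / 2"
proof -
  have "1 \<le> (1 - x + x\<^sup>2 / 2) * (1 + x + x\<^sup>2 / 2)"
  proof -
    have "(1 - x + x\<^sup>2 / 2) * (1 + x + x\<^sup>2 / 2) = 1 + (x\<^sup>2 / 2)\<^sup>2"
      by (simp add: power2_eq_square algebra_simps)
    then show ?thesis by simp
  qed
  also have "\<dots> \<le> (1 - x + x\<^sup>2 / 2) * exp x"
  proof (rule mult_left_mono)
    show "1 + x + x\<^sup>2 / 2 \<le> exp x" using exp_lower_Taylor_quadratic[OF assms] .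
    have "0 \<le> (1 - x)\<^sup>2" by simp
    then show "0 \<le> 1 - x + x\<^sup>2 / 2" by (simp add: power2_eq_square algebra_simps)
  qed
  finally show ?thesis by (simp add: exp_minus field_simps)
qed

text \<open>The weighted exponential of the losses, shifted so that they start at \<open>0\<close>, is at most
\<open>1 - \<eta> * x + \<eta>\<^sup>2 * R\<^sup>2 / 2\<close>, where \<open>x\<close> is the shifted expected loss; then \<open>ln z \<le> z - 1\<close>.
Hoeffding's lemma would give \<open>1 / 8\<close> in place of \<open>1 / 2\<close>.\<close>

lemma expected_loss_le_mix_loss:
  fixes q L :: "'e \<Rightarrow> real"
  assumes "finite N" and q: "\<And>j. j \<in> N \<Longrightarrow> 0 < q j" "sum q N = 1"
    and L: "\<And>j. j \<in> N \<Longrightarrow> lo \<le> L j \<and> L j \<le> lo + R" and \<eta>: "0 < \<eta>"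
  shows "\<eta> * (\<Sum>j\<in>N. q j * L j) \<le> - ln (\<Sum>j\<in>N. q j * exp (- \<eta> * L j)) + \<eta>\<^sup>2 * R\<^sup>2 / 2"
proof -
  let ?Z = "\<Sum>j\<in>N. q j * exp (- \<eta> * L j)"
  have "N \<noteq> {}" using q(2) by auto
  then have Z: "0 < ?Z" using assms by (intro sum_pos) auto
  have "exp (\<eta> * lo) * ?Z = (\<Sum>j\<in>N. q j * exp (- (\<eta> * (L j - lo))))"
    by (simp add: sum_distrib_left exp_add[symmetric] algebra_simps mult_exp_exp)
  also have "\<dots> \<le> (\<Sum>j\<in>N. q j * (1 - \<eta> * (L j - lo) + \<eta>\<^sup>2 * R\<^sup>2 / 2))"
  proof (rule sum_mono)
    fix j assume j: "j \<in> N"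
    have nn: "0 \<le> \<eta> * (L j - lo)" using L[OF j] \<eta> by simp
    have "\<eta> * (L j - lo) \<le> \<eta> * R" using L[OF j] \<eta> by simp
    then have "(\<eta> * (L j - lo))\<^sup>2 \<le> \<eta>\<^sup>2 * R\<^sup>2"
      using power_mono[OF _ nn, of "\<eta> * R" 2] by (simp add: power_mult_distrib)
    then have "exp (- (\<eta> * (L j - lo))) \<le> 1 - \<eta> * (L j - lo) + \<eta>\<^sup>2 * R\<^sup>2 / 2"
      using exp_minus_le_quadratic[OF nn] by simp
    then show "q j * exp (- (\<eta> * (L j - lo))) \<le> q j * (1 - \<eta> * (L j - lo) + \<eta>\<^sup>2 * R\<^sup>2 / 2)"
      using q(1)[OF j] by simp
  qed
  also have "\<dots> = (\<Sum>j\<in>N. q j * (1 + \<eta> * lo + \<eta>\<^sup>2 * R\<^sup>2 / 2) - \<eta> * (q j * L j))"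
    by (simp add: algebra_simps)
  also have "\<dots> = 1 + \<eta> * lo + \<eta>\<^sup>2 * R\<^sup>2 / 2 - \<eta> * (\<Sum>j\<in>N. q j * L j)"
    by (simp only: sum_subtractf sum_distrib_left[symmetric] sum_distrib_right[symmetric] q(2))
       simp
  finally have le: "exp (\<eta> * lo) * ?Z \<le> \<dots>" .
  have "\<eta> * lo + ln ?Z = ln (exp (\<eta> * lo) * ?Z)" using Z by (simp add: ln_mult)
  also have "\<dots> \<le> exp (\<eta> * lo) * ?Z - 1" using Z by (intro ln_le_minus_one) simp
  finally show ?thesis using le by simp
qed

lemma exp_update_simplex:
  assumes "finite N" "N \<noteq> {}" and q: "\<forall>j\<in>N. 0 < q j"
  shows "(\<forall>j\<in>N. 0 < exp_update N \<eta> L q j) \<and> sum (exp_update N \<eta> L q) N = 1"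
proof -
  have Z: "0 < (\<Sum>k\<in>N. q k * exp (- \<eta> * L k))"
    using assms by (intro sum_pos) auto
  then show ?thesis
    unfolding exp_update_def using q by (auto simp: sum_divide_distrib[symmetric])
qed

text \<open>An update multiplies each weight by at least \<open>exp (- \<eta> * R)\<close>, hence removes at most the fraction
\<open>\<eta> * R\<close> of it. Both weight vectors have the same mass, so the total variation is twice what is
removed.\<close>

lemma exp_update_drift:
  fixes q L :: "'e \<Rightarrow> real"
  assumes "finite N" and q: "\<And>j. j \<in> N \<Longrightarrow> 0 < q j" "sum q N = 1"
    and L: "\<And>j. j \<in> N \<Longrightarrow> lo \<le> L j \<and> L j \<le> lo + R" and \<eta>: "0 < \<eta>" and R: "0 \<le> R"
  shows "(\<Sum>j\<in>N. \<bar>exp_update N \<eta> L q j - q j\<bar>) \<le> 2 * \<eta> * R"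
proof -
  let ?Z = "\<Sum>j\<in>N. q j * exp (- \<eta> * L j)"
  let ?p = "exp_update N \<eta> L q"
  have "N \<noteq> {}" using q(2) by auto
  then have Z: "0 < ?Z" using assms by (intro sum_pos) auto
  have "?Z \<le> (\<Sum>j\<in>N. q j * exp (- \<eta> * lo))"
    using q L \<eta> by (intro sum_mono) (auto intro!: mult_left_mono simp: less_imp_le)
  then have Z_le: "?Z \<le> exp (- \<eta> * lo)" by (simp add: sum_distrib_right[symmetric] q(2))
  have "\<bar>?p j - q j\<bar> \<le> (?p j - q j) + 2 * \<eta> * R * q j" if j: "j \<in> N" for j
  proof -
    have "q j * (1 - \<eta> * R) \<le> q j * exp (- (\<eta> * R))"
      using q(1)[OF j] exp_ge_add_one_self[of "- (\<eta> * R)"] by (intro mult_left_mono) auto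
    also have "\<dots> = q j * exp (- \<eta> * (lo + R)) / exp (- \<eta> * lo)"
    proof -
      have "exp (- \<eta> * (lo + R)) = exp (- (\<eta> * R)) * exp (- \<eta> * lo)"
        by (simp add: exp_add[symmetric] algebra_simps)
      then show ?thesis by simp
    qed
    also have "\<dots> \<le> q j * exp (- \<eta> * L j) / ?Z"
      using q(1)[OF j] L[OF j] \<eta> Z Z_le by (intro frac_le mult_left_mono) auto
    finally have lb: "q j * (1 - \<eta> * R) \<le> ?p j" by (simp add: exp_update_def)
    moreover have "0 \<le> \<eta> * R * q j" using \<eta> R q(1)[OF j] by simp
    ultimately show ?thesis by (simp add: algebra_simps abs_if)
  qed
  then have "(\<Sum>j\<in>N. \<bar>?p j - q j\<bar>) \<le> (\<Sum>j\<in>N. (?p j - q j) + 2 * \<eta> * R * q j)"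
    by (rule sum_mono)
  also have "\<dots> = 2 * \<eta> * R"
    using exp_update_simplex[OF assms(1) \<open>N \<noteq> {}\<close>, of q \<eta> L] q(1)
    by (simp add: sum.distrib sum_subtractf sum_distrib_left[symmetric] q(2))
  finally show ?thesis .
qed

section \<open>Fixed Share against switching experts\<close>

lemma fixed_share_simplex:
  assumes N: "finite N" "N \<noteq> {}" and \<alpha>: "0 \<le> \<alpha>" "\<alpha> < 1" and "1 \<le> t"
  shows "(\<forall>j\<in>N. 0 < fixed_share N \<eta> \<alpha> L t j) \<and> sum (fixed_share N \<eta> \<alpha> L t) N = 1"
  using \<open>1 \<le> t\<close>
proof (induction t rule: dec_induct)
  case base
  then show ?case using N by (auto simp: card_gt_0_iff)
next
  case (step t)
  let ?p = "exp_update N \<eta> (\<lambda>k. L k t) (fixed_share N \<eta> \<alpha> L t)"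
  have eq: "fixed_share N \<eta> \<alpha> L (Suc t) = (\<lambda>j. (1 - \<alpha>) * ?p j + \<alpha> / real (card N))"
    using step by auto
  have p: "\<And>j. j \<in> N \<Longrightarrow> 0 < ?p j" and ps: "sum ?p N = 1"
    using exp_update_simplex[OF N, of "fixed_share N \<eta> \<alpha> L t"] step.IH by auto
  have "0 < (1 - \<alpha>) * ?p j + \<alpha> / real (card N)" if "j \<in> N" for j
    using p[OF that] \<alpha> by (intro add_pos_nonneg) auto
  moreover have "(\<Sum>j\<in>N. (1 - \<alpha>) * ?p j + \<alpha> / real (card N)) = 1"
    using N ps by (simp add: sum.distrib sum_distrib_left[symmetric])
  ultimately show ?case unfolding eq by auto
qed

lemma fixed_share_drift:
  assumes N: "finite N" "N \<noteq> {}" and \<alpha>: "0 \<le> \<alpha>" "\<alpha> < 1" and "1 \<le> t"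
    and L: "\<And>j. j \<in> N \<Longrightarrow> lo \<le> L j t \<and> L j t \<le> lo + R" and \<eta>: "0 < \<eta>" and R: "0 \<le> R"
  shows "(\<Sum>j\<in>N. \<bar>fixed_share N \<eta> \<alpha> L (Suc t) j - fixed_share N \<eta> \<alpha> L t j\<bar>)
         \<le> 2 * \<eta> * R + 2 * \<alpha>"
proof -
  let ?q = "fixed_share N \<eta> \<alpha> L t"
  let ?p = "exp_update N \<eta> (\<lambda>k. L k t) ?q"
  have q: "\<And>j. j \<in> N \<Longrightarrow> 0 < ?q j" "sum ?q N = 1"
    using fixed_share_simplex[OF N \<alpha> \<open>1 \<le> t\<close>] by auto
  have p: "\<And>j. j \<in> N \<Longrightarrow> 0 < ?p j" "sum ?p N = 1"
    using exp_update_simplex[OF N, of ?q] q by auto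
  have "\<bar>fixed_share N \<eta> \<alpha> L (Suc t) j - ?q j\<bar>
          \<le> \<bar>?p j - ?q j\<bar> + (\<alpha> / real (card N) + \<alpha> * ?p j)" if "j \<in> N" for j
  proof -
    have "fixed_share N \<eta> \<alpha> L (Suc t) j - ?q j = (?p j - ?q j) + (\<alpha> / real (card N) - \<alpha> * ?p j)"
      using \<open>1 \<le> t\<close> by (simp add: algebra_simps)
    moreover have "0 \<le> \<alpha> / real (card N)" "0 \<le> \<alpha> * ?p j" using \<alpha> p(1)[OF that] by (auto simp: less_imp_le)
    ultimately show ?thesis by linarith
  qed
  then have "(\<Sum>j\<in>N. \<bar>fixed_share N \<eta> \<alpha> L (Suc t) j - ?q j\<bar>)
      \<le> (\<Sum>j\<in>N. \<bar>?p j - ?q j\<bar> + (\<alpha> / real (card N) + \<alpha> * ?p j))"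
    by (rule sum_mono)
  also have "\<dots> = (\<Sum>j\<in>N. \<bar>?p j - ?q j\<bar>) + 2 * \<alpha>"
    using N p(2) by (simp add: sum.distrib sum_distrib_left[symmetric])
  finally show ?thesis using exp_update_drift[where L = "\<lambda>k. L k t", OF N(1) q L \<eta> R] by simp
qed

text \<open>Follow the weight of the comparator's current expert. After the exponential update, a share
\<open>1 - \<alpha>\<close> of it remains if the comparator stays; if it switches, the new expert has weight at least
\<open>\<alpha> / n\<close>, hence at least \<open>\<alpha> / n\<close> times the updated weight of the old one. Taking logarithms and
telescoping gives the claim, since the weight starts at \<open>1 / n\<close> and never exceeds \<open>1\<close>.\<close>

lemma fixed_share_mix_loss:
  assumes N: "finite N" "N \<noteq> {}" and \<alpha>: "0 \<le> \<alpha>" "\<alpha> < 1" and T: "1 \<le> T"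
    and js: "\<And>t. 1 \<le> t \<Longrightarrow> t \<le> T \<Longrightarrow> js t \<in> N"
    and sw: "\<And>t. 1 \<le> t \<Longrightarrow> t < T \<Longrightarrow> js t \<noteq> js (t + 1) \<Longrightarrow> 0 < \<alpha>"
  shows "- (\<Sum>t=1..T. ln (\<Sum>k\<in>N. fixed_share N \<eta> \<alpha> L t k * exp (- \<eta> * L k t)))
    \<le> \<eta> * (\<Sum>t=1..T. L (js t) t) + ln (real (card N))
      + (\<Sum>t=1..<T. if js t \<noteq> js (t + 1) then ln (real (card N) / \<alpha>) else ln (1 / (1 - \<alpha>)))"
proof -
  let ?q = "fixed_share N \<eta> \<alpha> L"
  let ?Z = "\<lambda>t. \<Sum>k\<in>N. ?q t k * exp (- \<eta> * L k t)"
  let ?p = "\<lambda>t. exp_update N \<eta> (\<lambda>k. L k t) (?q t)"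
  let ?pen = "\<lambda>t. if js t \<noteq> js (t + 1) then ln (real (card N) / \<alpha>) else ln (1 / (1 - \<alpha>))"
  have n: "0 < real (card N)" using N by (simp add: card_gt_0_iff)
  have q: "0 < ?q t j" if "1 \<le> t" "j \<in> N" for t j
    using fixed_share_simplex[OF N \<alpha> that(1)] that(2) by auto
  have Z: "0 < ?Z t" if "1 \<le> t" for t using q[OF that] N by (intro sum_pos) auto
  have p: "0 < ?p t j" "?p t j \<le> 1" if "1 \<le> t" "j \<in> N" for t j
  proof -
    have s: "\<forall>j\<in>N. 0 < ?p t j" "sum (?p t) N = 1"
      using exp_update_simplex[OF N, of "?q t"] q[OF that(1)] by auto
    show "0 < ?p t j" using s(1) that(2) by blast
    show "?p t j \<le> 1"
      using member_le_sum[OF that(2), of "?p t"] s N(1) by (auto simp: less_imp_le)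
  qed
  have lnp: "ln (?p t j) = ln (?q t j) - \<eta> * L j t - ln (?Z t)" if "1 \<le> t" "j \<in> N" for t j
    using q[OF that] Z[OF that(1)] by (simp add: exp_update_def ln_div ln_mult)
  have main: "- ln (?q t (js t)) \<le> ln (real (card N))
      + (\<Sum>s=1..<t. ln (?Z s) + \<eta> * L (js s) s + ?pen s)" if "1 \<le> t" "t \<le> T" for t
    using that
  proof (induction t rule: dec_induct)
    case base
    then show ?case by (simp add: ln_div)
  next
    case (step t)
    have jt: "js t \<in> N" using js step by simp
    have "ln (?p t (js t)) - ?pen t \<le> ln (?q (Suc t) (js (Suc t)))"
    proof (cases "js t = js (Suc t)")
      case True
      have "(1 - \<alpha>) * ?p t (js t) \<le> ?q (Suc t) (js (Suc t))"
        using True step.hyps \<alpha> n by simp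
      moreover have "0 < (1 - \<alpha>) * ?p t (js t)" using p(1)[OF step.hyps(1) jt] \<alpha> by simp
      ultimately have "ln ((1 - \<alpha>) * ?p t (js t)) \<le> ln (?q (Suc t) (js (Suc t)))" by simp
      then show ?thesis using True p(1)[OF step.hyps(1) jt] \<alpha> by (simp add: ln_mult ln_div)
    next
      case False
      have \<alpha>0: "0 < \<alpha>" using sw[of t] False step by simp
      have "js (Suc t) \<in> N" using js step by simp
      then have "0 < ?p t (js (Suc t))" using p(1)[OF step.hyps(1)] by simp
      then have "\<alpha> / real (card N) \<le> ?q (Suc t) (js (Suc t))"
        using step.hyps \<alpha> by simp
      moreover have "\<alpha> / real (card N) * ?p t (js t) \<le> \<alpha> / real (card N) * 1"
        using p[OF step.hyps(1) jt] \<alpha>0 n by (intro mult_left_mono) auto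
      ultimately have "\<alpha> / real (card N) * ?p t (js t) \<le> ?q (Suc t) (js (Suc t))" by simp
      moreover have "0 < \<alpha> / real (card N) * ?p t (js t)"
        using p(1)[OF step.hyps(1) jt] \<alpha>0 n by simp
      ultimately have "ln (\<alpha> / real (card N) * ?p t (js t)) \<le> ln (?q (Suc t) (js (Suc t)))"
        using ln_mono by blast
      then show ?thesis using False p(1)[OF step.hyps(1) jt] \<alpha>0 n
        by (simp add: ln_mult ln_div del: fixed_share.simps)
    qed
    then show ?case
      using step lnp[OF step.hyps(1) jt] by (simp del: fixed_share.simps)
  qed
  have "ln (?p T (js T)) \<le> 0" using p[OF T js[OF T]] by simp
  then have "- ln (?Z T) \<le> - ln (?q T (js T)) + \<eta> * L (js T) T"
    using lnp[OF T js[OF T]] by simp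
  also have "\<dots> \<le> ln (real (card N)) + (\<Sum>s=1..<T. ln (?Z s) + \<eta> * L (js s) s + ?pen s)
      + \<eta> * L (js T) T"
    using main[OF T] by simp
  finally have fin: "- ln (?Z T) \<le> \<dots>" .
  have split: "(\<Sum>t=1..T. f t) = (\<Sum>t=1..<T. f t) + f T" for f :: "nat \<Rightarrow> real"
    using T by (metis atLeastLessThanSuc_atLeastAtMost sum.atLeastLessThan_Suc)
  show ?thesis
    unfolding split using fin by (simp add: sum.distrib sum_distrib_left algebra_simps)
qed

text \<open>The real-valued closed form of \<open>complexity\<close>. With \<open>1 / 0 = 0\<close> and \<open>ln 0 = 0\<close> it is also
right for \<open>\<alpha> = 0\<close>, \<open>K = 0\<close>, so that the three tuning rules can be treated alike.\<close>

definition switching_complexity :: "nat \<Rightarrow> real \<Rightarrow> nat \<Rightarrow> nat \<Rightarrow> real" where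
  "switching_complexity K \<alpha> n T = (real K + 1) * ln (real n) + real K * ln (1 / \<alpha>)
     + (real T - real K - 1) * ln (1 / (1 - \<alpha>))"

text \<open>For \<open>\<alpha> \<le> 1/2\<close> a switch is penalised more than a stay, so fewer than \<open>K\<close> switches never cost more
than exactly \<open>K\<close>.\<close>

lemma switching_penalty_le:
  assumes n: "2 \<le> n" and \<alpha>: "0 \<le> \<alpha>" "\<alpha> \<le> 1/2" and T: "1 \<le> T"
    and S: "num_switches T js \<le> K" and K: "\<alpha> = 0 \<Longrightarrow> K = 0"
  shows "ln (real n)
      + (\<Sum>t=1..<T. if js t \<noteq> js (t + 1) then ln (real n / \<alpha>) else ln (1 / (1 - \<alpha>)))
    \<le> switching_complexity K \<alpha> n T"
proof -
  let ?S = "num_switches T js"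
  have part: "{1..<T} = {t \<in> {1..<T}. js t \<noteq> js (t + 1)} \<union> {t \<in> {1..<T}. js t = js (t + 1)}"
    by auto
  have "card {1..<T} = card {t \<in> {1..<T}. js t \<noteq> js (t + 1)} + card {t \<in> {1..<T}. js t = js (t + 1)}"
    by (subst part, rule card_Un_disjoint) auto
  then have stay: "real (card {t \<in> {1..<T}. js t = js (t + 1)}) = real T - 1 - real ?S"
    using T by (simp add: num_switches_def)
  have "(\<Sum>t=1..<T. if js t \<noteq> js (t + 1) then ln (real n / \<alpha>) else ln (1 / (1 - \<alpha>)))
      = real ?S * ln (real n / \<alpha>) + (real T - 1 - real ?S) * ln (1 / (1 - \<alpha>))"
    using stay by (subst sum.If_cases) (simp_all add: num_switches_def Int_def)
  also have "\<dots> \<le> real K * ln (real n / \<alpha>) + (real T - 1 - real K) * ln (1 / (1 - \<alpha>))"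
  proof (cases "\<alpha> = 0")
    case True
    then show ?thesis using K S by simp
  next
    case False
    have "1 / (1 - \<alpha>) \<le> 2" using \<alpha> by (simp add: field_simps)
    also have "\<dots> \<le> real n / \<alpha>" using False \<alpha> n by (simp add: field_simps)
    finally have "ln (1 / (1 - \<alpha>)) \<le> ln (real n / \<alpha>)" using \<alpha> by (intro ln_mono) auto
    then have "(real K - real ?S) * ln (1 / (1 - \<alpha>)) \<le> (real K - real ?S) * ln (real n / \<alpha>)"
      using S by (intro mult_left_mono) auto
    then show ?thesis by (simp add: algebra_simps)
  qed
  also have "real K * ln (real n / \<alpha>) = real K * ln (real n) + real K * ln (1 / \<alpha>)"
    using K n \<alpha> by (cases "\<alpha> = 0") (auto simp: ln_div algebra_simps)
  finally show ?thesis unfolding switching_complexity_def by (simp add: algebra_simps)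
qed

section \<open>From experts to the aggregate portfolio\<close>

lemma norm1_portfolio:
  assumes "v \<in> portfolios"
  shows "norm1 v = 1"
  using assms by (simp add: portfolios_def norm1_def)

lemma norm1_add_le: "norm1 (u + v) \<le> norm1 u + norm1 v"
  unfolding norm1_def by (simp add: sum.distrib[symmetric] sum_mono)

lemma norm1_sum_scale_le:
  "norm1 (\<Sum>j\<in>N. r j *\<^sub>R u j) \<le> (\<Sum>j\<in>N. \<bar>r j\<bar> * norm1 (u j))"
proof -
  have "norm1 (\<Sum>j\<in>N. r j *\<^sub>R u j) \<le> (\<Sum>i\<in>UNIV. \<Sum>j\<in>N. \<bar>r j\<bar> * \<bar>u j $ i\<bar>)"
    unfolding norm1_def
    by (intro sum_mono) (auto simp: abs_mult[symmetric] sum_component intro: sum_abs)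
  also have "\<dots> = (\<Sum>j\<in>N. \<bar>r j\<bar> * norm1 (u j))"
    unfolding norm1_def by (subst sum.swap) (simp add: sum_distrib_left)
  finally show ?thesis .
qed

lemma norm1_diff_portfolios_le:
  assumes "u \<in> portfolios" "v \<in> portfolios"
  shows "norm1 (u - v) \<le> 2"
  using norm1_add_le[of u "- v"] norm1_portfolio[OF assms(1)] norm1_portfolio[OF assms(2)]
  by (simp add: norm1_def)

text \<open>The displacement of the aggregate splits into the displacement of the experts under the current
weights, which is part of their losses, and the displacement of the weights, which is at most
\<open>\<delta>\<close> because portfolios have norm \<open>1\<close>. In the first round all experts come from the same \<open>w0\<close>, so
only the first part occurs.\<close>

lemma cost_loss_aggregate_le:
  fixes w :: "'e \<Rightarrow> nat \<Rightarrow> real ^ 'm"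
  assumes N: "finite N" and t: "1 \<le> t"
    and q: "\<And>j. j \<in> N \<Longrightarrow> 0 \<le> q t j" "sum (q t) N = 1"
    and conv: "convex_on portfolios (\<lambda>u. loss u (y t))"
    and w: "\<And>j t. j \<in> N \<Longrightarrow> 1 \<le> t \<Longrightarrow> w j t \<in> portfolios" "\<And>j. j \<in> N \<Longrightarrow> w j 0 = w0"
    and c: "0 \<le> c t"
    and drift: "t \<noteq> 1 \<Longrightarrow> (\<Sum>j\<in>N. \<bar>q t j - q (t - 1) j\<bar>) \<le> \<delta>" and \<delta>: "0 \<le> \<delta>"
  shows "cost_loss loss y c (aggregate N q w w0) t
         \<le> (\<Sum>j\<in>N. q t j * cost_loss loss y c (w j) t) + c t * \<delta>"
proof -
  let ?A = "aggregate N q w w0"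
  have "N \<noteq> {}" using q(2) by auto
  have At: "?A t = (\<Sum>j\<in>N. q t j *\<^sub>R w j t)" using t by (simp add: aggregate_def)
  have "loss (?A t) (y t) \<le> (\<Sum>j\<in>N. q t j * loss (w j t) (y t))"
    unfolding At using convex_on_sum[OF N \<open>N \<noteq> {}\<close> conv q(2) q(1), of "\<lambda>j. w j t"] w(1) t by simp
  moreover have "norm1 (?A t - ?A (t - 1))
      \<le> (\<Sum>j\<in>N. q t j * norm1 (w j t - w j (t - 1))) + \<delta>"
  proof -
    have move: "norm1 (\<Sum>j\<in>N. q t j *\<^sub>R (w j t - w j (t - 1)))
        \<le> (\<Sum>j\<in>N. q t j * norm1 (w j t - w j (t - 1)))"
      using norm1_sum_scale_le[where r = "q t" and u = "\<lambda>j. w j t - w j (t - 1)" and N = N] q(1) by simp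
    show ?thesis
    proof (cases "t = 1")
      case True
      have "w0 = (\<Sum>j\<in>N. q t j *\<^sub>R w j 0)"
        using w(2) q(2) by (simp add: scaleR_left.sum[symmetric])
      then have "?A t - ?A (t - 1) = (\<Sum>j\<in>N. q t j *\<^sub>R (w j t - w j (t - 1)))"
        using True by (simp add: At[unfolded True] scaleR_diff_right sum_subtractf)
                      (simp add: aggregate_def)
      then show ?thesis using move \<delta> by simp
    next
      case False
      then have t1: "1 \<le> t - 1" using t by simp
      have "?A t - ?A (t - 1) = (\<Sum>j\<in>N. q t j *\<^sub>R (w j t - w j (t - 1)))
          + (\<Sum>j\<in>N. (q t j - q (t - 1) j) *\<^sub>R w j (t - 1))"
        using t1 by (simp add: At scaleR_diff_right scaleR_diff_left sum_subtractf)
                    (simp add: aggregate_def)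
      moreover have "norm1 (\<Sum>j\<in>N. (q t j - q (t - 1) j) *\<^sub>R w j (t - 1)) \<le> \<delta>"
        using norm1_sum_scale_le[where r = "\<lambda>j. q t j - q (t - 1) j"
            and u = "\<lambda>j. w j (t - 1)" and N = N]
          norm1_portfolio[OF w(1)[OF _ t1]] drift[OF False] by simp
      ultimately show ?thesis
        using norm1_add_le[of "\<Sum>j\<in>N. q t j *\<^sub>R (w j t - w j (t - 1))"
            "\<Sum>j\<in>N. (q t j - q (t - 1) j) *\<^sub>R w j (t - 1)"] move by simp
    qed
  qed
  then have "c t * norm1 (?A t - ?A (t - 1))
      \<le> c t * ((\<Sum>j\<in>N. q t j * norm1 (w j t - w j (t - 1))) + \<delta>)"
    using c by (rule mult_left_mono)
  ultimately show ?thesis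
    by (simp add: cost_loss_def sum.distrib sum_distrib_left algebra_simps)
qed

text \<open>The cost-sensitive losses lie in \<open>{a..a + R}\<close> with \<open>R = b - a + 2\<close>, because two portfolios are at
distance at most \<open>2\<close> and \<open>c t \<le> 1\<close>. The bounds for single rounds are summed against a comparator
that attains the minimum.\<close>

lemma fixed_share_regret_bound:
  fixes w :: "'e \<Rightarrow> nat \<Rightarrow> real ^ 'm"
  assumes N: "finite N" "2 \<le> card N" and "a < b"
    and conv: "\<And>v. v \<in> Y \<Longrightarrow> convex_on portfolios (\<lambda>u. loss u v)"
    and bnd: "\<And>u v. u \<in> portfolios \<Longrightarrow> v \<in> Y \<Longrightarrow> a \<le> loss u v \<and> loss u v \<le> b"
    and w0: "w0 \<in> portfolios"
    and w: "\<And>j. j \<in> N \<Longrightarrow> w j 0 = w0" "\<And>j t. j \<in> N \<Longrightarrow> 1 \<le> t \<Longrightarrow> w j t \<in> portfolios"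
    and y: "\<And>t. 1 \<le> t \<Longrightarrow> y t \<in> Y" and c: "\<And>t. 1 \<le> t \<Longrightarrow> 0 \<le> c t \<and> c t \<le> 1"
    and \<alpha>: "0 \<le> \<alpha>" "\<alpha> \<le> 1/2" and K: "\<alpha> = 0 \<Longrightarrow> K = 0" and \<eta>: "0 < \<eta>" and T: "1 \<le> T"
  shows "tracking_regret N loss y c w (fixed_share_portfolio N loss y c w w0 \<eta> \<alpha>) T K
    \<le> switching_complexity K \<alpha> (card N) T / \<eta>
      + real T * (\<eta> * ((b - a + 2)\<^sup>2 / 2 + 2 * (b - a + 2)) + 2 * \<alpha>)"
proof -
  define L where "L = (\<lambda>j. cost_loss loss y c (w j))"
  define q where "q = fixed_share N \<eta> \<alpha> L"
  define R where "R = b - a + 2"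
  let ?C = "switching_complexity K \<alpha> (card N) T"
  let ?G = "cost_loss loss y c (fixed_share_portfolio N loss y c w w0 \<eta> \<alpha>)"
  have N0: "N \<noteq> {}" using N by auto
  have R: "0 \<le> R" using \<open>a < b\<close> by (simp add: R_def)
  have \<alpha>1: "\<alpha> < 1" using \<alpha> by simp
  have wp: "w j t \<in> portfolios" if "j \<in> N" for j t
    using w w0 that by (cases t) auto
  have L: "a \<le> L j t \<and> L j t \<le> a + R" if "j \<in> N" "1 \<le> t" for j t
  proof -
    let ?d = "norm1 (w j t - w j (t - 1))"
    have d: "0 \<le> ?d" "?d \<le> 2"
      using norm1_diff_portfolios_le[OF wp[OF that(1)] wp[OF that(1)]]
      by (auto simp: norm1_def sum_nonneg)
    have "0 \<le> c t * ?d" "c t * ?d \<le> 1 * 2"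
      using c[OF that(2)] d by (simp, intro mult_mono) auto
    then show ?thesis using bnd[OF wp[OF that(1)] y[OF that(2)], of t]
      by (auto simp: L_def cost_loss_def R_def)
  qed
  have q: "\<And>j. j \<in> N \<Longrightarrow> 0 < q t j" "sum (q t) N = 1" if "1 \<le> t" for t
    using fixed_share_simplex[OF N(1) N0 \<alpha>(1) \<alpha>1 that] by (auto simp: q_def)
  let ?\<delta> = "2 * \<eta> * R + 2 * \<alpha>"
  have \<delta>: "0 \<le> ?\<delta>" using \<eta> R \<alpha> by simp
  have round: "?G t \<le> - ln (\<Sum>k\<in>N. q t k * exp (- \<eta> * L k t)) / \<eta> + \<eta> * R\<^sup>2 / 2 + ?\<delta>"
    if t: "1 \<le> t" for t
  proof -
    have "?G t \<le> (\<Sum>j\<in>N. q t j * L j t) + c t * ?\<delta>"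
      unfolding fixed_share_portfolio_def L_def[symmetric] q_def[symmetric] unfolding L_def
    proof (rule cost_loss_aggregate_le[where y = y and \<delta> = ?\<delta>])
      show "0 \<le> q t j" if "j \<in> N" for j using q(1)[OF t that] by simp
      show "(\<Sum>j\<in>N. \<bar>q t j - q (t - 1) j\<bar>) \<le> ?\<delta>" if "t \<noteq> 1"
      proof -
        have t1: "1 \<le> t - 1" "Suc (t - 1) = t" using that t by auto
        show ?thesis
          using fixed_share_drift[OF N(1) N0 \<alpha>(1) \<alpha>1 t1(1), of a L R \<eta>] L[OF _ t1(1)] \<eta> R
          unfolding t1(2) q_def by blast
      qed
    qed (use N t q(2)[OF t] conv[OF y[OF t]] w c[OF t] \<delta> in auto)
    also have "c t * ?\<delta> \<le> ?\<delta>" using c[OF t] \<delta> by (simp add: mult_left_le_one_le)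
    finally have 1: "?G t \<le> (\<Sum>j\<in>N. q t j * L j t) + ?\<delta>" by simp
    have "\<eta> * (\<Sum>j\<in>N. q t j * L j t) \<le> - ln (\<Sum>k\<in>N. q t k * exp (- \<eta> * L k t)) + \<eta>\<^sup>2 * R\<^sup>2 / 2"
      using expected_loss_le_mix_loss[OF N(1) q[OF t], where L = "\<lambda>j. L j t" and lo = a]
        L[OF _ t] \<eta> by blast
    then have "(\<Sum>j\<in>N. q t j * L j t)
        \<le> (- ln (\<Sum>k\<in>N. q t k * exp (- \<eta> * L k t)) + \<eta>\<^sup>2 * R\<^sup>2 / 2) / \<eta>"
      using \<eta> by (simp add: field_simps)
    also have "\<dots> = - ln (\<Sum>k\<in>N. q t k * exp (- \<eta> * L k t)) / \<eta> + \<eta> * R\<^sup>2 / 2"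
      using \<eta> by (simp add: field_simps power2_eq_square)
    finally show ?thesis using 1 by linarith
  qed
  have compare: "(\<Sum>t=1..T. ?G t) - (\<Sum>t=1..T. L (js t) t)
      \<le> ?C / \<eta> + real T * (\<eta> * (R\<^sup>2 / 2 + 2 * R) + 2 * \<alpha>)" if js: "js \<in> switch_seqs N T K" for js
  proof -
    have jN: "js t \<in> N" if "1 \<le> t" "t \<le> T" for t
      using js that by (auto simp: switch_seqs_def PiE_def)
    have S: "num_switches T js \<le> K" using js by (simp add: switch_seqs_def)
    have sw: "0 < \<alpha>" if "1 \<le> t" "t < T" "js t \<noteq> js (t + 1)" for t
    proof (rule ccontr)
      assume "\<not> 0 < \<alpha>"
      then have "num_switches T js = 0" using \<alpha> K S by simp
      then have "{t \<in> {1..<T}. js t \<noteq> js (t + 1)} = {}" by (simp add: num_switches_def)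
      then show False using that by auto
    qed
    have "(\<Sum>t=1..T. ?G t) \<le> (\<Sum>t=1..T. - ln (\<Sum>k\<in>N. q t k * exp (- \<eta> * L k t)) / \<eta>
        + \<eta> * R\<^sup>2 / 2 + ?\<delta>)"
      using round by (intro sum_mono) auto
    also have "\<dots> = - (\<Sum>t=1..T. ln (\<Sum>k\<in>N. q t k * exp (- \<eta> * L k t))) / \<eta>
        + real T * (\<eta> * (R\<^sup>2 / 2 + 2 * R) + 2 * \<alpha>)"
      by (simp only: sum.distrib sum_negf sum_divide_distrib[symmetric]) (simp add: algebra_simps)
    also have "- (\<Sum>t=1..T. ln (\<Sum>k\<in>N. q t k * exp (- \<eta> * L k t)))
        \<le> \<eta> * (\<Sum>t=1..T. L (js t) t) + ?C"
    proof -
      have "- (\<Sum>t=1..T. ln (\<Sum>k\<in>N. q t k * exp (- \<eta> * L k t)))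
        \<le> \<eta> * (\<Sum>t=1..T. L (js t) t) + ln (real (card N))
          + (\<Sum>t=1..<T. if js t \<noteq> js (t + 1) then ln (real (card N) / \<alpha>) else ln (1 / (1 - \<alpha>)))"
        unfolding q_def by (rule fixed_share_mix_loss) (use N N0 \<alpha> \<alpha>1 T jN sw in auto)
      with switching_penalty_le[OF N(2) \<alpha> T S K] show ?thesis by linarith
    qed
    then have "- (\<Sum>t=1..T. ln (\<Sum>k\<in>N. q t k * exp (- \<eta> * L k t))) / \<eta>
        \<le> (\<eta> * (\<Sum>t=1..T. L (js t) t) + ?C) / \<eta>"
      using \<eta> by (intro divide_right_mono) auto
    finally show ?thesis using \<eta> by (simp add: add_divide_distrib)
  qed
  let ?V = "(\<lambda>js. \<Sum>t=1..T. L (js t) t) ` switch_seqs N T K"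
  have "switch_seqs N T K \<subseteq> {1..T} \<rightarrow>\<^sub>E N" by (auto simp: switch_seqs_def)
  then have fin: "finite ?V" using N(1) by (meson finite_PiE finite_atLeastAtMost finite_imageI finite_subset)
  obtain j0 where "j0 \<in> N" using N0 by auto
  have const: "(\<lambda>t. if t \<in> {1..T} then j0 else undefined) \<in> switch_seqs N T K"
    using \<open>j0 \<in> N\<close> by (auto simp: switch_seqs_def num_switches_def)
  then have "?V \<noteq> {}" by blast
  then have "Min ?V \<in> ?V" using fin by simp
  then obtain js where "js \<in> switch_seqs N T K" "Min ?V = (\<Sum>t=1..T. L (js t) t)" by auto
  then show ?thesis using compare unfolding tracking_regret_def L_def R_def by simp
qed

section \<open>The balance equation for the mixing parameter\<close>

text \<open>In the following, \<open>k\<close> is the number of switches, \<open>M\<close> the number of stays, and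
\<open>B + k * ln (1 / \<alpha>) + M * ln (1 / (1 - \<alpha>))\<close> the complexity as a function of \<open>\<alpha>\<close>. Then
\<open>k / \<alpha> - M / (1 - \<alpha>)\<close> is its negative derivative, which vanishes at \<open>k / (k + M)\<close>.\<close>

lemma marginal_complexity_alt:
  fixes k M \<alpha> :: real
  assumes "0 < \<alpha>" "\<alpha> < 1"
  shows "k / \<alpha> - M / (1 - \<alpha>) = (k - (k + M) * \<alpha>) / (\<alpha> * (1 - \<alpha>))"
  using assms by (simp add: field_simps)

lemma stay_cost_le:
  fixes k M \<alpha> :: real
  assumes "0 \<le> M" "\<alpha> < 1" "\<alpha> * (k + M) \<le> k"
  shows "M * ln (1 / (1 - \<alpha>)) \<le> k"
proof -
  have "M * ln (1 / (1 - \<alpha>)) \<le> M * (1 / (1 - \<alpha>) - 1)"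
    using assms by (intro mult_left_mono ln_le_minus_one) auto
  also have "\<dots> = M * \<alpha> / (1 - \<alpha>)" using assms by (simp add: field_simps)
  also have "\<dots> \<le> k" using assms by (simp add: field_simps)
  finally show ?thesis .
qed

lemma ln_le_two_sqrt:
  fixes u :: real
  assumes "0 < u"
  shows "ln u \<le> 2 * sqrt u"
  using ln_bound[of "sqrt u"] assms by (simp add: ln_sqrt)

text \<open>Up to half of \<open>k / (k + M)\<close> the marginal complexity is at least \<open>k / (2 * \<alpha>)\<close>, while the complexity
itself is at most \<open>(B + 2 * k) / \<alpha>\<close>. So for small \<open>\<alpha>\<close> the left side of the balance equation
wins. This shows both that a solution exists and that no solution is very small.\<close>

lemma sqrt_complexity_less_marginal:
  fixes k M B D \<alpha> :: real
  assumes k: "0 < k" and M: "0 < M" and B: "0 < B" and \<alpha>: "0 < \<alpha>" "\<alpha> \<le> k / (k + M) / 2"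
    and small: "4 * D\<^sup>2 * (B + 2 * k) * \<alpha> < k\<^sup>2"
  shows "D * sqrt (B + k * ln (1 / \<alpha>) + M * ln (1 / (1 - \<alpha>))) < k / \<alpha> - M / (1 - \<alpha>)"
proof (rule power2_less_imp_less)
  let ?C = "B + k * ln (1 / \<alpha>) + M * ln (1 / (1 - \<alpha>))"
  have half: "(k + M) * \<alpha> \<le> k / 2" using \<alpha> k M by (simp add: field_simps)
  have "k / (k + M) / 2 < 1" using k M by (simp add: field_simps)
  with \<alpha>(2) have \<alpha>1: "\<alpha> < 1" by (rule le_less_trans)
  have "k * ln (1 / \<alpha>) \<le> k * (1 / \<alpha>)" using k \<alpha> by (intro mult_left_mono ln_bound) auto
  moreover have "M * ln (1 / (1 - \<alpha>)) \<le> k"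
    using half k M by (intro stay_cost_le \<alpha>1) (auto simp: mult.commute)
  ultimately have "?C \<le> B + k + k / \<alpha>" by simp
  also have "B + k \<le> (B + k) / \<alpha>"
    using mult_left_le[of \<alpha> "B + k"] k B \<alpha> \<alpha>1 by (simp add: pos_le_divide_eq)
  finally have C_le: "?C \<le> (B + 2 * k) / \<alpha>" by (simp add: add_divide_distrib)
  have "0 \<le> k * ln (1 / \<alpha>)" "0 \<le> M * ln (1 / (1 - \<alpha>))" using k M \<alpha> \<alpha>1 by auto
  then have "(D * sqrt ?C)\<^sup>2 = D\<^sup>2 * ?C" using B by (simp add: power_mult_distrib)
  also have "\<dots> \<le> D\<^sup>2 * ((B + 2 * k) / \<alpha>)" using C_le by (rule mult_left_mono) simp
  also have "\<dots> = (4 * D\<^sup>2 * (B + 2 * k) * \<alpha>) / (4 * \<alpha>\<^sup>2)"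
    using \<alpha>(1) by (simp add: power2_eq_square)
  also have "\<dots> < k\<^sup>2 / (4 * \<alpha>\<^sup>2)" using small \<alpha>(1) by (intro divide_strict_right_mono) auto
  also have "\<dots> = (k / (2 * \<alpha>))\<^sup>2" by (simp add: power_divide power_mult_distrib)
  also have "\<dots> \<le> (k / \<alpha> - M / (1 - \<alpha>))\<^sup>2"
  proof (rule power_mono)
    have "k / (2 * \<alpha>) = (k / 2) / \<alpha>" by simp
    also have "\<dots> \<le> (k - (k + M) * \<alpha>) / (\<alpha> * (1 - \<alpha>))"
      using half k \<alpha> \<alpha>1 by (intro frac_le) (auto simp: mult_left_le)
    finally show "k / (2 * \<alpha>) \<le> k / \<alpha> - M / (1 - \<alpha>)"
      by (simp only: marginal_complexity_alt[OF \<alpha>(1) \<alpha>1])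
  qed (use k \<alpha> in auto)
  finally show "(D * sqrt ?C)\<^sup>2 < (k / \<alpha> - M / (1 - \<alpha>))\<^sup>2" .
  show "0 \<le> k / \<alpha> - M / (1 - \<alpha>)"
    unfolding marginal_complexity_alt[OF \<alpha>(1) \<alpha>1] using half k \<alpha> \<alpha>1 by simp
qed

text \<open>Existence is the intermediate value theorem. For uniqueness, a solution satisfies
\<open>C'\<^sup>2 / C = D\<^sup>2\<close>, and \<open>C'\<^sup>2 / C\<close> is strictly decreasing if \<open>C'\<^sup>2 < 2 * C * C''\<close>. This holds because
\<open>C'\<^sup>2 \<le> k\<^sup>2 / \<alpha>\<^sup>2\<close>, \<open>C'' \<ge> k / \<alpha>\<^sup>2\<close> and \<open>C \<ge> B > k / 2\<close>.\<close>

lemma ex1_balance: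
  fixes k M B D :: real
  assumes k: "0 < k" and M: "0 < M" and B: "k / 2 < B" and D: "0 < D"
  shows "\<exists>!\<alpha>. \<alpha> \<in> {0<..<k / (k + M)} \<and>
    k / \<alpha> - M / (1 - \<alpha>) = D * sqrt (B + k * ln (1 / \<alpha>) + M * ln (1 / (1 - \<alpha>)))"
proof -
  define P where "P = (\<lambda>\<alpha>. k / \<alpha> - M / (1 - \<alpha>))"
  define C where "C = (\<lambda>\<alpha>. B + k * ln (1 / \<alpha>) + M * ln (1 / (1 - \<alpha>)))"
  define \<alpha>0 where "\<alpha>0 = k / (k + M)"
  have \<alpha>0: "0 < \<alpha>0" "\<alpha>0 < 1" using k M by (auto simp: \<alpha>0_def)
  have C_ge: "B \<le> C \<alpha>" if "0 < \<alpha>" "\<alpha> < 1" for \<alpha>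
    using that k M by (auto simp: C_def)
  have "\<exists>\<alpha>. \<alpha> \<in> {0<..<\<alpha>0} \<and> P \<alpha> = D * sqrt (C \<alpha>)"
  proof -
    \<comment> \<open>Twice the constant of \<open>sqrt_complexity_less_marginal\<close>, to get its strict inequality at \<open>\<epsilon>\<close>.\<close>
    define X where "X = 8 * D\<^sup>2 * (B + 2 * k)"
    have X: "0 < X" using D B k by (simp add: X_def)
    define \<epsilon> where "\<epsilon> = min (\<alpha>0 / 2) (k\<^sup>2 / X)"
    have \<epsilon>: "0 < \<epsilon>" "\<epsilon> \<le> \<alpha>0 / 2"
      unfolding \<epsilon>_def using X k \<alpha>0 by (simp, intro min.cobounded1)
    have "X * \<epsilon> \<le> k\<^sup>2" using X by (simp add: \<epsilon>_def min_def field_simps)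
    moreover have "0 < k\<^sup>2" using k by simp
    moreover have "4 * D\<^sup>2 * (B + 2 * k) * \<epsilon> = X * \<epsilon> / 2" by (simp add: X_def)
    ultimately have "4 * D\<^sup>2 * (B + 2 * k) * \<epsilon> < k\<^sup>2" by linarith
    then have left: "D * sqrt (C \<epsilon>) < P \<epsilon>"
      using sqrt_complexity_less_marginal[OF k M _ \<epsilon>[unfolded \<alpha>0_def]] B k
      by (simp add: P_def C_def)
    have "P \<alpha>0 = 0" using k M by (simp add: P_def \<alpha>0_def field_simps)
    moreover have "0 < D * sqrt (C \<alpha>0)" using C_ge[OF \<alpha>0] B k D by simp
    ultimately have right: "P \<alpha>0 < D * sqrt (C \<alpha>0)" by simp
    have cont: "continuous_on {\<epsilon>..\<alpha>0} (\<lambda>\<alpha>. P \<alpha> - D * sqrt (C \<alpha>))"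
      unfolding P_def C_def using \<epsilon> \<alpha>0 by (auto intro!: continuous_intros)
    have "\<exists>\<alpha>\<ge>\<epsilon>. \<alpha> \<le> \<alpha>0 \<and> P \<alpha> - D * sqrt (C \<alpha>) = 0"
      using left right \<epsilon> \<alpha>0 by (intro IVT2' cont) auto
    then obtain \<alpha> where \<alpha>: "\<epsilon> \<le> \<alpha>" "\<alpha> \<le> \<alpha>0" "P \<alpha> = D * sqrt (C \<alpha>)" by auto
    have "\<alpha> \<noteq> \<alpha>0" using \<alpha>(3) right by auto
    then have "\<alpha> \<in> {0<..<\<alpha>0}" using \<alpha> \<epsilon> by simp
    then show ?thesis using \<alpha>(3) by blast
  qed
  moreover have "\<alpha> = \<beta>"
    if "\<alpha> \<in> {0<..<\<alpha>0}" "P \<alpha> = D * sqrt (C \<alpha>)" "\<beta> \<in> {0<..<\<alpha>0}" "P \<beta> = D * sqrt (C \<beta>)" for \<alpha> \<beta>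
    using that
  proof (induction \<alpha> \<beta> rule: linorder_wlog)
    case (le \<alpha> \<beta>)
    have D2: "(P x)\<^sup>2 / C x = D\<^sup>2" if "x \<in> {0<..<\<alpha>0}" "P x = D * sqrt (C x)" for x
      using that C_ge[of x] \<alpha>0 B k by (simp add: power_mult_distrib)
    show ?case
    proof (rule ccontr)
      assume "\<alpha> \<noteq> \<beta>"
      then have "\<alpha> < \<beta>" using le by simp
      then have "(P \<beta>)\<^sup>2 / C \<beta> < (P \<alpha>)\<^sup>2 / C \<alpha>"
      proof (rule DERIV_neg_imp_decreasing)
        fix x assume x: "\<alpha> \<le> x" "x \<le> \<beta>"
        have x01: "0 < x" "x < 1" and xlt: "x < \<alpha>0" using x le \<alpha>0 by auto
        have Cx: "0 < C x" using C_ge[OF x01] B k by simp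
        have Px: "0 < P x"
          unfolding P_def marginal_complexity_alt[OF x01] using xlt k M x01
          by (simp add: \<alpha>0_def field_simps)
        define P' where "P' = - (k / x\<^sup>2) - M / (1 - x)\<^sup>2"
        have dP: "(P has_real_derivative P') (at x)"
          unfolding P_def P'_def using x01
          by (auto intro!: derivative_eq_intros simp: power2_eq_square)
        \<comment> \<open>The logarithms are split first, which is valid near \<open>x\<close> only.\<close>
        have dC: "(C has_real_derivative - P x) (at x)"
        proof -
          have d: "((\<lambda>\<alpha>. B - k * ln \<alpha> - M * ln (1 - \<alpha>)) has_real_derivative - P x) (at x)"
            unfolding P_def using x01 by (auto intro!: derivative_eq_intros)
          have "\<forall>\<^sub>F z in nhds x. z \<in> {0<..<1}"
            using x01 by (intro eventually_nhds_in_open) auto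
          then have ev: "\<forall>\<^sub>F z in nhds x. B - k * ln z - M * ln (1 - z) = C z"
            by eventually_elim (simp add: C_def ln_div)
          show ?thesis using d DERIV_cong_ev[OF refl ev refl] by blast
        qed
        have "((\<lambda>\<alpha>. (P \<alpha>)\<^sup>2 / C \<alpha>) has_real_derivative
            (2 * P x * P' * C x - (P x)\<^sup>2 * (- P x)) / (C x * C x)) (at x)"
          using dP dC Cx by (auto intro!: derivative_eq_intros)
        moreover have "(2 * P x * P' * C x - (P x)\<^sup>2 * (- P x)) / (C x * C x) < 0"
        proof -
          have "(P x)\<^sup>2 \<le> (k / x)\<^sup>2" using Px M x01 by (intro power_mono) (auto simp: P_def)
          also have "\<dots> = k * (k / x\<^sup>2)" by (simp add: power2_eq_square)
          also have "\<dots> < 2 * B * (k / x\<^sup>2)"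
            using B k x01 by (intro mult_strict_right_mono) auto
          also have "\<dots> \<le> 2 * C x * (k / x\<^sup>2)"
            using C_ge[OF x01] k by (intro mult_right_mono) auto
          also have "\<dots> \<le> 2 * C x * (- P')"
            using Cx M by (intro mult_left_mono) (auto simp: P'_def)
          finally have "2 * P' * C x + (P x)\<^sup>2 < 0" by (simp add: algebra_simps)
          then have "P x * (2 * P' * C x + (P x)\<^sup>2) < 0" using Px by (simp add: mult_pos_neg)
          moreover have "2 * P x * P' * C x - (P x)\<^sup>2 * (- P x) = P x * (2 * P' * C x + (P x)\<^sup>2)"
            by (simp add: algebra_simps power2_eq_square)
          ultimately show ?thesis using Cx by (simp add: divide_neg_pos)
        qed
        ultimately show "\<exists>y. ((\<lambda>\<alpha>. (P \<alpha>)\<^sup>2 / C \<alpha>) has_real_derivative y) (at x) \<and> y < 0"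
          by blast
      qed
      then show False using D2[of \<alpha>] D2[of \<beta>] le by simp
    qed
  next
    case (sym \<alpha> \<beta>)
    then show ?case by blast
  qed
  ultimately show ?thesis unfolding P_def C_def \<alpha>0_def by blast
qed

section \<open>Size of the tuned parameters\<close>

lemma A_const_bounds:
  assumes "a < b" and c: "\<And>t. 1 \<le> t \<Longrightarrow> 0 \<le> c t \<and> c t \<le> 1"
  shows "real T * ((b - a)\<^sup>2 / 8) \<le> A_const a b c T"
    and "A_const a b c T \<le> real T * ((b - a + 2)\<^sup>2 / 8 + (b - a + 2))"
proof -
  have sq: "(b - a)\<^sup>2 \<le> (b - a + 2 * c t)\<^sup>2" "(b - a + 2 * c t)\<^sup>2 \<le> (b - a + 2)\<^sup>2" if "1 \<le> t" for t
    using c[OF that] \<open>a < b\<close> by (auto intro!: power_mono)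
  have cross: "0 \<le> c t * (b - a + 2 * c (t - 1))" "c t * (b - a + 2 * c (t - 1)) \<le> b - a + 2"
    if "2 \<le> t" for t
  proof -
    have "0 \<le> c t" "c t \<le> 1" "0 \<le> c (t - 1)" "c (t - 1) \<le> 1" using c[of t] c[of "t - 1"] that by auto
    then show "0 \<le> c t * (b - a + 2 * c (t - 1))" "c t * (b - a + 2 * c (t - 1)) \<le> b - a + 2"
      using \<open>a < b\<close> mult_mono[of "c t" 1 "b - a + 2 * c (t - 1)" "b - a + 2"] by auto
  qed
  have "real T * (b - a)\<^sup>2 \<le> (\<Sum>t=1..T. (b - a + 2 * c t)\<^sup>2)"
    using sum_bounded_below[of "{1..T}" "(b - a)\<^sup>2" "\<lambda>t. (b - a + 2 * c t)\<^sup>2"] sq by simp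
  moreover have "0 \<le> (\<Sum>t=2..T. c t * (b - a + 2 * c (t - 1)))"
    using cross by (intro sum_nonneg) auto
  ultimately show "real T * ((b - a)\<^sup>2 / 8) \<le> A_const a b c T" by (simp add: A_const_def)
  have "(\<Sum>t=1..T. (b - a + 2 * c t)\<^sup>2) \<le> real T * (b - a + 2)\<^sup>2"
    using sum_bounded_above[of "{1..T}" "\<lambda>t. (b - a + 2 * c t)\<^sup>2" "(b - a + 2)\<^sup>2"] sq by simp
  moreover have "(\<Sum>t=2..T. c t * (b - a + 2 * c (t - 1))) \<le> real (card {2..T}) * (b - a + 2)"
    using sum_bounded_above[of "{2..T}" "\<lambda>t. c t * (b - a + 2 * c (t - 1))" "b - a + 2"] cross by simp
  moreover have "real (card {2..T}) * (b - a + 2) \<le> real T * (b - a + 2)"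
    using \<open>a < b\<close> by (intro mult_right_mono) auto
  ultimately show "A_const a b c T \<le> real T * ((b - a + 2)\<^sup>2 / 8 + (b - a + 2))"
    by (simp add: A_const_def distrib_left)
qed

lemma A_const_costless:
  assumes "C_const c T = 0" and c: "\<And>t. 1 \<le> t \<Longrightarrow> 0 \<le> c t"
  shows "A_const a b c T = real T * (b - a)\<^sup>2 / 8"
proof -
  have c0: "c t = 0" if "t \<in> {1..T}" for t
    using assms that sum_nonneg_eq_0_iff[of "{1..T}" c] by (simp add: C_const_def)
  then have "(\<Sum>t=1..T. (b - a + 2 * c t)\<^sup>2) = real T * (b - a)\<^sup>2"
    "(\<Sum>t=2..T. c t * (b - a + 2 * c (t - 1))) = 0" by simp_all
  then show ?thesis by (simp add: A_const_def)
qed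

lemma real_of_complexity:
  assumes "\<alpha> = 0 \<Longrightarrow> K = 0"
  shows "real_of_ereal (complexity K \<alpha> n T) = switching_complexity K \<alpha> n T"
  using assms by (auto simp: complexity_def switching_complexity_def algebra_simps)

lemma switching_complexity_entropy:
  assumes "2 \<le> T"
  shows "switching_complexity K (real K / (real T - 1)) n T
    = (real K + 1) * ln (real n) + (real T - 1) * binary_entropy (real K / (real T - 1))"
proof -
  let ?x = "real K / (real T - 1)"
  have T: "real T - 1 \<noteq> 0" using assms by simp
  have H: "(real T - 1) * binary_entropy ?x = - (real K) * ln ?x - (real T - 1 - real K) * ln (1 - ?x)"
  proof -
    have "m * (- x * ln x - (1 - x) * ln (1 - x)) = - (m * x) * ln x - (m * (1 - x)) * ln (1 - x)"
      for m x :: real by (simp add: algebra_simps)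
    moreover have "(real T - 1) * ?x = real K" "(real T - 1) * (1 - ?x) = real T - 1 - real K"
      using T by (simp_all add: right_diff_distrib)
    ultimately show ?thesis unfolding binary_entropy_def by (simp only:)
  qed
  have ln_inv: "ln (1 / z) = - ln z" for z :: real
    by (cases "z = 0") (simp_all add: ln_div)
  show ?thesis unfolding switching_complexity_def ln_inv H by (simp add: algebra_simps)
qed

text \<open>For \<open>B = (K + 1) * ln n\<close> this gives the inequality \<open>K / 2 < B\<close> that makes the balance equation
uniquely solvable.\<close>

lemma half_less_ln:
  assumes "2 \<le> n"
  shows "1/2 < ln (real n)"
proof -
  have "exp (1/2 :: real) ^ 2 = exp 1" using exp_double[of "1/2 :: real"] by simp
  also have "\<dots> < 2 ^ 2" using e_less_272 by simp
  finally have "exp (1/2 :: real) < 2" by (rule power2_less_imp_less) simp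
  also have "\<dots> \<le> real n" using assms by simp
  finally show ?thesis using assms ln_less_cancel_iff[of "exp (1/2)" "real n"] by simp
qed

text \<open>Dividing by \<open>sqrt A\<close> brings the defining equation into the form of \<open>ex1_balance\<close> with
\<open>D = 2 * (1 - 1 / n) * C_const / sqrt A\<close>, where \<open>D\<^sup>2 \<le> 32 * T / (b - a)\<^sup>2\<close>. If \<open>\<alpha>\<close> is below half of
\<open>K / (T - 1)\<close>, then \<open>sqrt_complexity_less_marginal\<close> forces
\<open>K\<^sup>2 \<le> 4 * D\<^sup>2 * (B + 2 * K) * \<alpha>\<close>, which is linear in \<open>K * T\<close> on the right; this is where the
constant \<open>256\<close> comes from.\<close>

lemma alpha_star_solution:
  assumes n: "2 \<le> n" and "a < b" and c: "\<And>t. 1 \<le> t \<Longrightarrow> 0 \<le> c t \<and> c t \<le> 1"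
    and K: "1 \<le> K" "K + 2 \<le> T" and C: "0 < C_const c T"
  defines "\<alpha> \<equiv> alpha_star n a b c T K"
  shows "0 < \<alpha>" "\<alpha> < real K / (real T - 1)"
    and "1 / \<alpha> \<le> (2 + 256 * (ln (real n) + 1) / (b - a)\<^sup>2) * (real T / real K)"
proof -
  let ?\<alpha>0 = "real K / (real T - 1)"
  let ?A = "A_const a b c T"
  let ?d = "b - a"
  define B where "B = (real K + 1) * ln (real n)"
  define M where "M = real T - 1 - real K"
  define D where "D = 2 * (1 - 1 / real n) * C_const c T / sqrt ?A"
  have k: "0 < real K" and M: "0 < M" and kM: "real K + M = real T - 1"
    using K by (auto simp: M_def)
  have d: "0 < ?d" using \<open>a < b\<close> by simp
  have T: "0 < real T" using K by simp
  have A: "real T * (?d\<^sup>2 / 8) \<le> ?A" using A_const_bounds(1)[OF \<open>a < b\<close> c] .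
  have "0 < real T * (?d\<^sup>2 / 8)" using T d by simp
  then have A0: "0 < ?A" using A by linarith
  have "0 < 1 - 1 / real n" using n by simp
  then have D: "0 < D" using C A0 unfolding D_def by (intro divide_pos_pos mult_pos_pos) auto
  have lnn: "1/2 < ln (real n)" using half_less_ln[OF n] .
  have "(real K + 1) * (1/2) < (real K + 1) * ln (real n)"
    using lnn by (intro mult_strict_left_mono) auto
  moreover have "real K / 2 \<le> (real K + 1) * (1/2)" by simp
  ultimately have B: "real K / 2 < B" unfolding B_def by linarith
  have eq: "alpha_equation n a b c T K x \<longleftrightarrow>
      real K / x - M / (1 - x) = D * sqrt (B + real K * ln (1 / x) + M * ln (1 / (1 - x)))"
    if "x \<in> {0<..<?\<alpha>0}" for x
  proof -
    have "?\<alpha>0 < 1" using K by simp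
    then have x: "0 < x" "x < 1" using that by auto
    have "real_of_ereal (complexity K x n T) = B + real K * ln (1 / x) + M * ln (1 / (1 - x))"
      using real_of_complexity[of x K n T] x
      by (simp add: switching_complexity_def B_def M_def algebra_simps)
    then show ?thesis
      using marginal_complexity_alt[OF x, of "real K" M]
      unfolding alpha_equation_def by (simp add: kM D_def real_sqrt_divide)
  qed
  have "\<exists>!x. x \<in> {0<..<?\<alpha>0} \<and> alpha_equation n a b c T K x"
    using ex1_balance[OF k M B D] eq unfolding kM by (metis (no_types, lifting))
  then have sol: "\<alpha> \<in> {0<..<?\<alpha>0} \<and> alpha_equation n a b c T K \<alpha>"
    using theI'[of "\<lambda>x. x \<in> {0<..<?\<alpha>0} \<and> alpha_equation n a b c T K x"] C K
    by (simp add: \<alpha>_def alpha_star_def)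
  then show \<alpha>0: "0 < \<alpha>" and "\<alpha> < ?\<alpha>0" by auto
  have bal: "real K / \<alpha> - M / (1 - \<alpha>)
      = D * sqrt (B + real K * ln (1 / \<alpha>) + M * ln (1 / (1 - \<alpha>)))" using eq sol by blast
  have "\<not> (\<alpha> \<le> real K / (real K + M) / 2 \<and> 4 * D\<^sup>2 * (B + 2 * real K) * \<alpha> < (real K)\<^sup>2)"
    using sqrt_complexity_less_marginal[OF k M _ \<alpha>0, of B D] bal B k by auto
  then consider "?\<alpha>0 / 2 < \<alpha>" | "(real K)\<^sup>2 \<le> 4 * D\<^sup>2 * (B + 2 * real K) * \<alpha>"
    unfolding kM by linarith
  then show "1 / \<alpha> \<le> (2 + 256 * (ln (real n) + 1) / ?d\<^sup>2) * (real T / real K)"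
  proof cases
    case 1
    then have "real K \<le> 2 * \<alpha> * (real T - 1)" using K by (simp add: field_simps)
    also have "\<dots> \<le> 2 * \<alpha> * real T" using \<alpha>0 by simp
    finally have "1 / \<alpha> \<le> 2 * (real T / real K)" using \<alpha>0 k by (simp add: field_simps)
    moreover have "0 \<le> 256 * (ln (real n) + 1) / ?d\<^sup>2 * (real T / real K)" using lnn by simp
    ultimately show ?thesis by (simp only: distrib_right)
  next
    case 2
    have "C_const c T \<le> real T"
      unfolding C_const_def using sum_bounded_above[of "{1..T}" c 1] c by simp
    moreover have "1 - 1 / real n \<le> 1" by simp
    moreover have "0 \<le> 1 - 1 / real n" using n by simp
    ultimately have "(1 - 1 / real n) * C_const c T \<le> 1 * real T"
      using C by (intro mult_mono) auto
    then have "(2 * ((1 - 1 / real n) * C_const c T))\<^sup>2 \<le> (2 * real T)\<^sup>2"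
      using C \<open>0 \<le> 1 - 1 / real n\<close> by (intro power_mono) auto
    moreover have "D\<^sup>2 = (2 * ((1 - 1 / real n) * C_const c T))\<^sup>2 / ?A"
      using A0 by (simp only: D_def power_divide mult.assoc) simp
    ultimately have "D\<^sup>2 \<le> (2 * real T)\<^sup>2 / ?A"
      using A0 by (simp only: divide_right_mono less_imp_le)
    also have "\<dots> \<le> (2 * real T)\<^sup>2 / (real T * (?d\<^sup>2 / 8))"
      using A \<open>0 < real T * (?d\<^sup>2 / 8)\<close> by (intro divide_left_mono) auto
    also have "\<dots> = 32 * real T / ?d\<^sup>2" using T by (simp add: power2_eq_square)
    finally have D2: "D\<^sup>2 \<le> 32 * real T / ?d\<^sup>2" .
    have "(real K + 1) * ln (real n) \<le> (2 * real K) * ln (real n)"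
      using K lnn by (intro mult_right_mono) auto
    then have B2: "B + 2 * real K \<le> 2 * real K * (ln (real n) + 1)"
      by (simp add: B_def algebra_simps)
    have "(real K)\<^sup>2 \<le> 4 * (D\<^sup>2 * (B + 2 * real K)) * \<alpha>" using 2 by (simp add: mult.assoc)
    also have "\<dots> \<le> 4 * ((32 * real T / ?d\<^sup>2) * (2 * real K * (ln (real n) + 1))) * \<alpha>"
      using D2 B2 B k \<alpha>0 by (intro mult_right_mono mult_left_mono mult_mono) auto
    also have "\<dots> = real K * (256 * (ln (real n) + 1) / ?d\<^sup>2 * real T * \<alpha>)"
      by (simp add: field_simps)
    finally have "real K * real K \<le> real K * (256 * (ln (real n) + 1) / ?d\<^sup>2 * real T * \<alpha>)"
      by (simp only: power2_eq_square)
    then have "real K \<le> 256 * (ln (real n) + 1) / ?d\<^sup>2 * real T * \<alpha>"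
      using k by (rule mult_left_le_imp_le)
    moreover have "1 / \<alpha> \<le> Q * (real T / real K)" if "real K \<le> Q * real T * \<alpha>" for Q
      using that \<alpha>0 k by (simp add: field_simps)
    ultimately have "1 / \<alpha> \<le> 256 * (ln (real n) + 1) / ?d\<^sup>2 * (real T / real K)" by blast
    moreover have "0 \<le> 2 * (real T / real K)" by simp
    ultimately show ?thesis by (simp only: distrib_right)
  qed
qed

lemma switching_complexity_bounds:
  assumes n: "2 \<le> n" and K: "K + 2 \<le> T" and \<kappa>: "0 \<le> \<kappa>"
    and \<alpha>: "0 \<le> \<alpha>" "\<alpha> \<le> real K / (real T - 1)" "\<alpha> = 0 \<Longrightarrow> K = 0"
    and inv: "K \<noteq> 0 \<Longrightarrow> 1 / \<alpha> \<le> \<kappa> * (real T / real K)"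
  shows "ln (real n) \<le> switching_complexity K \<alpha> n T"
    and "switching_complexity K \<alpha> n T
      \<le> (real K + 1) * ln (real n) + real K + 2 * sqrt (\<kappa> * real T * real K)"
proof -
  have lnn: "0 < ln (real n)" using half_less_ln[OF n] by simp
  have "real K / (real T - 1) < 1" using K by simp
  then have \<alpha>1: "\<alpha> < 1" using \<alpha> by linarith
  have "0 \<le> real K * ln (1 / \<alpha>)" using \<alpha> \<alpha>1 by (cases "\<alpha> = 0") auto
  moreover have "0 \<le> (real T - real K - 1) * ln (1 / (1 - \<alpha>))" using K \<alpha> \<alpha>1 by simp
  moreover have "ln (real n) \<le> (real K + 1) * ln (real n)" using lnn by simp
  ultimately show "ln (real n) \<le> switching_complexity K \<alpha> n T"
    unfolding switching_complexity_def by linarith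
  have "(real T - real K - 1) * ln (1 / (1 - \<alpha>)) \<le> real K"
    using K \<alpha> by (intro stay_cost_le \<alpha>1) (auto simp: field_simps)
  moreover have "real K * ln (1 / \<alpha>) \<le> 2 * sqrt (\<kappa> * real T * real K)"
  proof (cases "K = 0")
    case False
    have a0: "0 < \<alpha>" using \<alpha> False by force
    have "ln (1 / \<alpha>) \<le> 2 * sqrt (1 / \<alpha>)" using a0 by (intro ln_le_two_sqrt) simp
    also have "\<dots> \<le> 2 * sqrt (\<kappa> * (real T / real K))" using inv[OF False] by simp
    finally have "real K * ln (1 / \<alpha>) \<le> real K * (2 * sqrt (\<kappa> * (real T / real K)))"
      by (rule mult_left_mono) simp
    also have "\<dots> = 2 * (sqrt ((real K)\<^sup>2) * sqrt (\<kappa> * (real T / real K)))" by simp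
    also have "\<dots> = 2 * sqrt (\<kappa> * real T * real K)"
      unfolding real_sqrt_mult[symmetric] using False by (simp add: power2_eq_square field_simps)
    finally show ?thesis .
  qed (use \<kappa> in simp)
  ultimately show "switching_complexity K \<alpha> n T
      \<le> (real K + 1) * ln (real n) + real K + 2 * sqrt (\<kappa> * real T * real K)"
    unfolding switching_complexity_def by linarith
qed

text \<open>The three tuning rules obey one description. In the costless case \<open>A = T * (b - a)\<^sup>2 / 8\<close> and the
entropy expression is the complexity at \<open>\<alpha> = K / (T - 1)\<close>.\<close>

lemma tuned_parameters:
  assumes n: "2 \<le> n" and "a < b" and c: "\<And>t. 1 \<le> t \<Longrightarrow> 0 \<le> c t \<and> c t \<le> 1"
    and K: "K + 2 \<le> T"
  defines "\<alpha> \<equiv> alpha_star n a b c T K"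
    and "\<kappa> \<equiv> 2 + 256 * (ln (real n) + 1) / (b - a)\<^sup>2"
  shows "0 \<le> \<alpha>" "\<alpha> \<le> real K / (real T - 1)" "\<alpha> = 0 \<Longrightarrow> K = 0"
    and "K \<noteq> 0 \<Longrightarrow> 1 / \<alpha> \<le> \<kappa> * (real T / real K)"
    and "eta_star n a b c T K = sqrt (switching_complexity K \<alpha> n T / A_const a b c T)"
proof -
  have lnn: "0 < ln (real n)" using half_less_ln[OF n] by simp
  have C0: "0 \<le> C_const c T" unfolding C_const_def using c by (intro sum_nonneg) auto
  have T: "2 \<le> T" using K by simp
  have \<kappa>: "1 \<le> \<kappa>" using lnn by (simp add: \<kappa>_def add_increasing2)
  have all: "0 \<le> \<alpha> \<and> \<alpha> \<le> real K / (real T - 1) \<and> (\<alpha> = 0 \<longrightarrow> K = 0)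
    \<and> (K \<noteq> 0 \<longrightarrow> 1 / \<alpha> \<le> \<kappa> * (real T / real K))
    \<and> eta_star n a b c T K = sqrt (switching_complexity K \<alpha> n T / A_const a b c T)"
  proof (cases "C_const c T = 0")
    case True
    then have \<alpha>: "\<alpha> = real K / (real T - 1)" by (simp add: \<alpha>_def alpha_star_def)
    have "eta_star n a b c T K = 1 / (b - a) * sqrt (8 / real T * switching_complexity K \<alpha> n T)"
      using True unfolding eta_star_def \<alpha> switching_complexity_entropy[OF T] by simp
    also have "\<dots> = sqrt (1 / (b - a)\<^sup>2) * sqrt (8 / real T * switching_complexity K \<alpha> n T)"
      using \<open>a < b\<close> by (simp add: real_sqrt_divide)
    also have "\<dots> = sqrt (switching_complexity K \<alpha> n T / A_const a b c T)"
    proof -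
      have "A_const a b c T = real T * (b - a)\<^sup>2 / 8"
        by (rule A_const_costless[OF True]) (use c in auto)
      then show ?thesis
        unfolding real_sqrt_mult[symmetric] by (simp only:) (simp add: field_simps)
    qed
    finally have \<eta>: "eta_star n a b c T K = \<dots>" .
    have "1 / \<alpha> \<le> \<kappa> * (real T / real K)" if "K \<noteq> 0"
    proof -
      have "1 / \<alpha> \<le> 1 * (real T / real K)" using that by (simp add: \<alpha> divide_right_mono)
      also have "\<dots> \<le> \<kappa> * (real T / real K)" using \<kappa> by (intro mult_right_mono) auto
      finally show ?thesis .
    qed
    then show ?thesis using \<eta> T by (auto simp: \<alpha>)
  next
    case False
    show ?thesis
    proof (cases "K = 0")
      case True
      then have "\<alpha> = 0" using False by (simp add: \<alpha>_def alpha_star_def)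
      moreover have "eta_star n a b c T K = sqrt (ln (real n) / A_const a b c T)"
        using True False by (simp add: eta_star_def)
      ultimately show ?thesis using True T by (simp add: switching_complexity_def)
    next
      case K0: False
      then have sol: "0 < \<alpha>" "\<alpha> < real K / (real T - 1)" "1 / \<alpha> \<le> \<kappa> * (real T / real K)"
        unfolding \<alpha>_def \<kappa>_def
        using alpha_star_solution[OF n \<open>a < b\<close> c _ K] False C0 by auto
      then show ?thesis
        using K0 False real_of_complexity[of \<alpha> K n T] by (auto simp: eta_star_def \<alpha>_def)
    qed
  qed
  then show "0 \<le> \<alpha>" "\<alpha> \<le> real K / (real T - 1)" "\<alpha> = 0 \<Longrightarrow> K = 0"
    "K \<noteq> 0 \<Longrightarrow> 1 / \<alpha> \<le> \<kappa> * (real T / real K)"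
    "eta_star n a b c T K = sqrt (switching_complexity K \<alpha> n T / A_const a b c T)" by auto
qed

section \<open>Vanishing average regret\<close>

text \<open>With \<open>\<eta> = sqrt (C / A)\<close> one has \<open>C / \<eta> = A * \<eta> = O(T * \<eta>)\<close>, so that \<open>\<eta>\<close> and \<open>\<alpha>\<close> alone control
the average regret, and \<open>\<eta>\<^sup>2 = O(C / T)\<close>. The condition \<open>4 * K \<le> T\<close> ensures \<open>\<alpha> \<le> 1/2\<close>.\<close>

lemma tuned_average_regret_le:
  fixes w :: "'e \<Rightarrow> nat \<Rightarrow> real ^ 'm"
  assumes N: "finite N" "2 \<le> card N" and "a < b"
    and conv: "\<And>v. v \<in> Y \<Longrightarrow> convex_on portfolios (\<lambda>u. loss u v)"
    and bnd: "\<And>u v. u \<in> portfolios \<Longrightarrow> v \<in> Y \<Longrightarrow> a \<le> loss u v \<and> loss u v \<le> b"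
    and w0: "w0 \<in> portfolios"
    and w: "\<And>j. j \<in> N \<Longrightarrow> w j 0 = w0" "\<And>j t. j \<in> N \<Longrightarrow> 1 \<le> t \<Longrightarrow> w j t \<in> portfolios"
    and y: "\<And>t. 1 \<le> t \<Longrightarrow> y t \<in> Y" and c: "\<And>t. 1 \<le> t \<Longrightarrow> 0 \<le> c t \<and> c t \<le> 1"
    and T: "4 \<le> T" and K: "4 * K \<le> T"
  defines "R \<equiv> b - a + 2" and "x \<equiv> real K / real T"
    and "n \<equiv> card N" and "\<kappa> \<equiv> 2 + 256 * (ln (real (card N)) + 1) / (b - a)\<^sup>2"
  shows "tracking_regret N loss y c w
      (fixed_share_portfolio N loss y c w w0 (eta_star n a b c T K) (alpha_star n a b c T K)) T K / real T
    \<le> (R\<^sup>2 / 8 + R + (R\<^sup>2 / 2 + 2 * R))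
        * sqrt (8 / (b - a)\<^sup>2 * (ln (real n) / real T + (ln (real n) + 1) * x + 2 * sqrt (\<kappa> * x)))
      + 4 * x"
proof -
  define \<alpha> where "\<alpha> = alpha_star n a b c T K"
  define \<eta> where "\<eta> = eta_star n a b c T K"
  define C where "C = switching_complexity K \<alpha> n T"
  define A where "A = A_const a b c T"
  define E where "E = ln (real n) / real T + (ln (real n) + 1) * x + 2 * sqrt (\<kappa> * x)"
  have n: "2 \<le> n" using N by (simp add: n_def)
  have KT: "K + 2 \<le> T" using T K by linarith
  have T0: "0 < real T" using T by simp
  have d: "0 < b - a" using \<open>a < b\<close> by simp
  have lnn: "0 < ln (real n)" using half_less_ln[OF n] by simp
  have \<kappa>: "0 \<le> \<kappa>" using lnn by (simp add: \<kappa>_def n_def)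
  note tp = tuned_parameters[OF n \<open>a < b\<close> c KT]
  have \<alpha>: "0 \<le> \<alpha>" "\<alpha> \<le> real K / (real T - 1)" "\<alpha> = 0 \<Longrightarrow> K = 0"
    using tp(1,2,3) by (auto simp: \<alpha>_def)
  have inv: "K \<noteq> 0 \<Longrightarrow> 1 / \<alpha> \<le> \<kappa> * (real T / real K)"
    using tp(4) by (simp add: \<alpha>_def \<kappa>_def n_def)
  have \<eta>: "\<eta> = sqrt (C / A)" using tp(5) by (simp add: \<eta>_def C_def A_def \<alpha>_def)
  have "real K / (real T - 1) \<le> 2 * x"
    using T mult_left_mono[of 2 "real T" "real K"] by (simp add: x_def field_simps)
  then have \<alpha>x: "\<alpha> \<le> 2 * x" using \<alpha>(2) by simp
  also have "2 * x \<le> 1/2" using K T by (simp add: x_def field_simps)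
  finally have \<alpha>_half: "\<alpha> \<le> 1/2" .
  note C = switching_complexity_bounds[OF n KT \<kappa> \<alpha> inv, folded C_def]
  have C0: "0 < C" using C(1) lnn by linarith
  have A: "real T * ((b - a)\<^sup>2 / 8) \<le> A" "A \<le> real T * (R\<^sup>2 / 8 + R)"
    using A_const_bounds[OF \<open>a < b\<close> c] by (simp_all add: A_def R_def)
  have Alow: "0 < real T * ((b - a)\<^sup>2 / 8)" using T0 d by simp
  then have A0: "0 < A" using A(1) by linarith
  have \<eta>0: "0 < \<eta>" using C0 A0 by (simp add: \<eta>)
  have "C = A * \<eta> * \<eta>" using C0 A0 by (simp add: \<eta> mult.assoc)
  then have "C / \<eta> = A * \<eta>" using \<eta>0 by simp
  also have "\<dots> \<le> real T * (R\<^sup>2 / 8 + R) * \<eta>" using A(2) \<eta>0 by (intro mult_right_mono) auto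
  finally have C\<eta>: "C / \<eta> \<le> \<dots>" .
  let ?G = "tracking_regret N loss y c w (fixed_share_portfolio N loss y c w w0 \<eta> \<alpha>) T K"
  have "?G \<le> C / \<eta> + real T * (\<eta> * (R\<^sup>2 / 2 + 2 * R) + 2 * \<alpha>)"
    unfolding C_def n_def R_def
    by (rule fixed_share_regret_bound[where Y = Y and a = a and b = b])
       (use N \<open>a < b\<close> conv bnd w0 w y c \<alpha> \<alpha>_half \<eta>0 T in auto)
  also have "\<dots> \<le> real T * ((R\<^sup>2 / 8 + R + (R\<^sup>2 / 2 + 2 * R)) * \<eta> + 2 * \<alpha>)"
    using C\<eta> by (simp add: algebra_simps)
  finally have G: "?G / real T \<le> (R\<^sup>2 / 8 + R + (R\<^sup>2 / 2 + 2 * R)) * \<eta> + 2 * \<alpha>"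
    using T0 by (simp add: pos_divide_le_eq mult.commute)
  have "C / A \<le> C / (real T * ((b - a)\<^sup>2 / 8))"
    using A(1) Alow C0 by (intro divide_left_mono) auto
  also have "\<dots> = 8 / (b - a)\<^sup>2 * (C / real T)" by (simp add: mult.commute)
  also have "\<dots> \<le> 8 / (b - a)\<^sup>2 * E"
  proof (rule mult_left_mono)
    have "\<kappa> * real T * real K = (real T)\<^sup>2 * (\<kappa> * x)"
      using T0 by (simp add: x_def power2_eq_square)
    then have "sqrt (\<kappa> * real T * real K) = real T * sqrt (\<kappa> * x)"
      by (simp only: real_sqrt_mult[of "(real T)\<^sup>2"] real_sqrt_abs abs_of_nat)
    moreover have "real K = real T * x" using T0 by (simp add: x_def)
    ultimately have "C \<le> (real T * x + 1) * ln (real n) + real T * x + 2 * (real T * sqrt (\<kappa> * x))"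
      using C(2) by simp
    also have "\<dots> = E * real T" using T0 by (simp add: E_def field_simps)
    finally show "C / real T \<le> E" using T0 by (simp add: pos_divide_le_eq)
  qed simp
  finally have "\<eta> \<le> sqrt (8 / (b - a)\<^sup>2 * E)" unfolding \<eta> by simp
  moreover have "0 \<le> R\<^sup>2 / 8 + R + (R\<^sup>2 / 2 + 2 * R)" using d by (simp add: R_def)
  ultimately have "(R\<^sup>2 / 8 + R + (R\<^sup>2 / 2 + 2 * R)) * \<eta>
      \<le> (R\<^sup>2 / 8 + R + (R\<^sup>2 / 2 + 2 * R)) * sqrt (8 / (b - a)\<^sup>2 * E)"
    by (rule mult_left_mono)
  then show ?thesis using G \<alpha>x unfolding \<alpha>_def \<eta>_def E_def by linarith
qed

theorem corollary3p7:
  fixes N :: "'e set"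
    and Y :: "(real ^ 'm) set"
    and loss :: "real ^ 'm \<Rightarrow> real ^ 'm \<Rightarrow> real"
    and a b :: real
    and w0 :: "real ^ 'm"
    and w :: "'e \<Rightarrow> nat \<Rightarrow> real ^ 'm"
    and y :: "nat \<Rightarrow> real ^ 'm"
    and c :: "nat \<Rightarrow> real"
    and K :: "nat \<Rightarrow> nat"
  assumes "CARD('m) \<ge> 2"
    and "finite N" and "card N \<ge> 2"
    and "a < b"
    and "\<And>v. v \<in> Y \<Longrightarrow> convex_on portfolios (\<lambda>u. loss u v)"
    and "\<And>u v. u \<in> portfolios \<Longrightarrow> v \<in> Y \<Longrightarrow> a \<le> loss u v \<and> loss u v \<le> b"
    and "w0 \<in> portfolios"
    and "\<And>j. j \<in> N \<Longrightarrow> w j 0 = w0"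
    and "\<And>j t. j \<in> N \<Longrightarrow> t \<ge> 1 \<Longrightarrow> w j t \<in> portfolios"
    and "\<And>t. t \<ge> 1 \<Longrightarrow> y t \<in> Y"
    and "\<And>t. t \<ge> 1 \<Longrightarrow> 0 \<le> c t \<and> c t \<le> 1"
    and "\<And>T. T \<ge> 1 \<Longrightarrow> K T \<le> T - 1"
    and "(\<lambda>T. real (K T)) \<in> o(\<lambda>T. real T)"
  shows "limsup (\<lambda>T. ereal (tracking_regret N loss y c w
             (fixed_share_portfolio N loss y c w w0
                (eta_star (card N) a b c T (K T)) (alpha_star (card N) a b c T (K T)))
             T (K T) / real T)) \<le> 0"
proof -
  define x where "x = (\<lambda>T. real (K T) / real T)"
  define R where "R = b - a + 2"
  define \<kappa> where "\<kappa> = 2 + 256 * (ln (real (card N)) + 1) / (b - a)\<^sup>2"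
  define g where "g = (\<lambda>T. (R\<^sup>2 / 8 + R + (R\<^sup>2 / 2 + 2 * R))
      * sqrt (8 / (b - a)\<^sup>2 * (ln (real (card N)) / real T + (ln (real (card N)) + 1) * x T
          + 2 * sqrt (\<kappa> * x T))) + 4 * x T)"
  let ?r = "\<lambda>T. tracking_regret N loss y c w
             (fixed_share_portfolio N loss y c w w0
                (eta_star (card N) a b c T (K T)) (alpha_star (card N) a b c T (K T)))
             T (K T) / real T"
  have x0: "x \<longlonglongrightarrow> 0" unfolding x_def using smalloD_tendsto[OF assms(13)] .
  have "(\<lambda>T. ln (real (card N)) / real T) \<longlonglongrightarrow> 0"
    by (rule lim_const_over_n)
  then have "g \<longlonglongrightarrow> (R\<^sup>2 / 8 + R + (R\<^sup>2 / 2 + 2 * R))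
      * sqrt (8 / (b - a)\<^sup>2 * (0 + (ln (real (card N)) + 1) * 0 + 2 * sqrt (\<kappa> * 0))) + 4 * 0"
    unfolding g_def using x0 by (intro tendsto_intros)
  then have "g \<longlonglongrightarrow> 0" by simp
  then have "(\<lambda>T. ereal (g T)) \<longlonglongrightarrow> ereal 0" by simp
  then have "limsup (\<lambda>T. ereal (g T)) = ereal 0"
    by (rule lim_imp_Limsup[OF sequentially_bot])
  moreover have "\<forall>\<^sub>F T in sequentially. ?r T \<le> g T"
  proof -
    have "\<forall>\<^sub>F T in sequentially. x T < 1 / 4" using order_tendstoD(2)[OF x0, of "1/4"] by simp
    moreover have "\<forall>\<^sub>F T in sequentially. 4 \<le> T" by (rule eventually_ge_at_top)
    ultimately show ?thesis
    proof eventually_elim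
      case (elim T)
      have "real (4 * K T) \<le> real T" using elim by (simp add: x_def field_simps)
      then have "4 * K T \<le> T" by (simp only: of_nat_le_iff)
      with \<open>4 \<le> T\<close> show ?case
        unfolding g_def x_def R_def \<kappa>_def
        by (intro tuned_average_regret_le[where Y = Y]) (use assms in auto)
    qed
  qed
  then have "\<forall>\<^sub>F T in sequentially. ereal (?r T) \<le> ereal (g T)" by simp
  then have "limsup (\<lambda>T. ereal (?r T)) \<le> limsup (\<lambda>T. ereal (g T))" by (rule Limsup_mono)
  ultimately show ?thesis by (simp add: zero_ereal_def)
qed

end
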